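(* Let $w \in S_n$ be a fully commutative permutation. Then $w$ is a minimal element of $\mathcal{C}_n$ (with respect to the right weak order) if and only if all of the following hold: (a) the set of descents of $w$ has the form $\{d, d+2, d+4, \ldots, d+2k\}$ for some $k \ge 2$; (b) the set $\{w(d), w(d+2), \ldots, w(d+2k)\}$ is crowded; (c) $w$ fixes every $i \in [1,n] \setminus [d, d+2k+1]$; (d) the pattern $415263$ occurs in $w$, and every occurrence of $415263$ in $w$ is consecutive (occupies consecutive positions); (e) for each $i \in [0,k-2]$, the consecutive subsequence $w(d+2i)\, w(d+2i+1) \cdots w(d+2i+5)$ is an occurrence of either the pattern $415263$ or the pattern $315264$.
   Context: A permutation is fully commutative iff it avoids $321$. $d$ is a descent of $w$ if $w(d)>w(d+1)$. The right weak order is the transitive closure of $w<ws_i$ when $\ell(ws_i)>\ell(w)$. $P(w)$ is the RSK insertion tableau and $\mathrm{Row}_2(P(w))$ the set of its second-row entries. A set $L$ of integers is crowded if there exist integers $x>0$, $y$ with $|[y,y+2x]\cap L|>x+1$. $\mathcal{C}_n$ is the set of fully commutative $w\in S_n$ with $\mathrm{Row}_2(P(w))$ crowded; a minimal element of $\mathcal{C}_n$ is an element of $\mathcal{C}_n$ with no other element of $\mathcal{C}_n$ below it in the right weak order. A permutation contains pattern $\sigma$ if it has a subsequence in the same relative order as $\sigma$. *)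

theory Defs
  imports "HOL-Combinatorics.Combinatorics"
begin

text \<open>
  An element of \<open>S\<^sub>n\<close> is a function \<open>w :: nat \<Rightarrow> nat\<close> with \<open>w permutes {1..n}\<close>; its one-line
  notation is \<open>w 1, \<dots>, w n\<close>.  Patterns are given in one-line notation, as lists.
\<close>

definition simple_refl :: "nat \<Rightarrow> nat \<Rightarrow> nat" where
  "simple_refl i = transpose i (i + 1)"

definition word_prod :: "nat list \<Rightarrow> nat \<Rightarrow> nat" where
  "word_prod is = foldr (\<lambda>i u. simple_refl i \<circ> u) is id"

definition coxeter_length :: "nat \<Rightarrow> (nat \<Rightarrow> nat) \<Rightarrow> nat" where
  "coxeter_length n w =
     (LEAST m. \<exists>is. length is = m \<and> set is \<subseteq> {1..<n} \<and> word_prod is = w)"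

definition right_weak_step :: "nat \<Rightarrow> (nat \<Rightarrow> nat) \<Rightarrow> (nat \<Rightarrow> nat) \<Rightarrow> bool" where
  "right_weak_step n u v \<longleftrightarrow> u permutes {1..n} \<and>
     (\<exists>i\<in>{1..<n}. v = u \<circ> simple_refl i \<and> coxeter_length n v > coxeter_length n u)"

definition right_weak_less :: "nat \<Rightarrow> (nat \<Rightarrow> nat) \<Rightarrow> (nat \<Rightarrow> nat) \<Rightarrow> bool" where
  "right_weak_less n = (right_weak_step n)\<^sup>+\<^sup>+"

definition descents :: "nat \<Rightarrow> (nat \<Rightarrow> nat) \<Rightarrow> nat set" where
  "descents n w = {d \<in> {1..<n}. w d > w (d + 1)}"

text \<open>The list \<open>ps\<close> holds the positions (not the values) of the occurrence.\<close>

definition occurrence :: "nat \<Rightarrow> (nat \<Rightarrow> nat) \<Rightarrow> nat list \<Rightarrow> nat list \<Rightarrow> bool" where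
  "occurrence n w \<sigma> ps \<longleftrightarrow>
     length ps = length \<sigma> \<and> sorted_wrt (<) ps \<and> set ps \<subseteq> {1..n} \<and>
     (\<forall>i<length \<sigma>. \<forall>j<length \<sigma>. w (ps ! i) < w (ps ! j) \<longleftrightarrow> \<sigma> ! i < \<sigma> ! j)"

definition contains_pattern :: "nat \<Rightarrow> (nat \<Rightarrow> nat) \<Rightarrow> nat list \<Rightarrow> bool" where
  "contains_pattern n w \<sigma> \<longleftrightarrow> (\<exists>ps. occurrence n w \<sigma> ps)"

definition consecutive_positions :: "nat list \<Rightarrow> bool" where
  "consecutive_positions ps \<longleftrightarrow> (\<exists>p. ps = [p..<p + length ps])"

definition fully_commutative :: "nat \<Rightarrow> (nat \<Rightarrow> nat) \<Rightarrow> bool" where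
  "fully_commutative n w \<longleftrightarrow> w permutes {1..n} \<and> \<not> contains_pattern n w [3, 2, 1]"

text \<open>
  Schensted row insertion: \<open>x\<close> replaces the leftmost entry larger than \<open>x\<close>, which is bumped into
  the next row; if there is no such entry, \<open>x\<close> is appended.
\<close>

fun row_insert :: "nat \<Rightarrow> nat list \<Rightarrow> nat list \<times> nat option" where
  "row_insert x [] = ([x], None)"
| "row_insert x (y # ys) =
     (if x < y then (x # ys, Some y)
      else (let (zs, b) = row_insert x ys in (y # zs, b)))"

fun tableau_insert :: "nat \<Rightarrow> nat list list \<Rightarrow> nat list list" where
  "tableau_insert x [] = [[x]]"
| "tableau_insert x (r # rs) =
     (case row_insert x r of
        (r', None) \<Rightarrow> r' # rs
      | (r', Some y) \<Rightarrow> r' # tableau_insert y rs)"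

definition insertion_tableau :: "nat \<Rightarrow> (nat \<Rightarrow> nat) \<Rightarrow> nat list list" where
  "insertion_tableau n w = fold (\<lambda>i. tableau_insert (w i)) [1..<n + 1] []"

definition row2 :: "nat list list \<Rightarrow> nat set" where
  "row2 T = (if length T \<ge> 2 then set (T ! 1) else {})"

definition crowded :: "int set \<Rightarrow> bool" where
  "crowded L \<longleftrightarrow> (\<exists>x y :: int. x > 0 \<and> int (card ({y..y + 2 * x} \<inter> L)) > x + 1)"

definition crowded_perms :: "nat \<Rightarrow> (nat \<Rightarrow> nat) set" where
  "crowded_perms n =
     {w. fully_commutative n w \<and> crowded (int ` row2 (insertion_tableau n w))}"

definition minimal_crowded :: "nat \<Rightarrow> (nat \<Rightarrow> nat) \<Rightarrow> bool" where
  "minimal_crowded n w \<longleftrightarrow>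
     w \<in> crowded_perms n \<and> \<not> (\<exists>u\<in>crowded_perms n. u \<noteq> w \<and> right_weak_less n u w)"

end

theory Submission
  imports Defs
begin

text \<open>
  Removing a descent from a 321-avoiding \<open>w\<close> either leaves the second row of \<open>P(w)\<close> unchanged or
  deletes one entry from it, so \<open>w\<close> is minimal in \<open>\<C>\<^sub>n\<close> iff its second row is crowded and removing
  any single descent destroys this. In that case the second row consists of the descent tops, and
  removing the descent \<open>i\<close> deletes the top of the last descent \<open>e\<close> of the maximal chain
  \<open>i, i + 2, \<dots>, e\<close> of descents with \<open>w j > w (j + 3)\<close> along the chain; there \<open>w\<close> maps \<open>[1, e + 1]\<close> to
  itself. Tops on the right of such a cut have density at most \<open>1/2\<close>, so a crowded interval across the
  cut would be crowded already on its left; hence there is only one chain. Writing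
  \<open>y\<^sub>0 x\<^sub>0 y\<^sub>1 x\<^sub>1 \<dots> y\<^sub>k x\<^sub>k\<close> for the word of the chain starting at \<open>d\<close>, one has \<open>y\<^sub>i = d + 2i + c\<^sub>i\<close>, where
  \<open>c\<^sub>i\<close> counts the \<open>l \<ge> i\<close> with \<open>x\<^sub>l < y\<^sub>i\<close>, and \<open>[y\<^sub>i, y\<^sub>j]\<close> is crowded iff \<open>c\<^sub>i \<ge> c\<^sub>j + 2\<close>. Since \<open>c\<^sub>k = 1\<close> and
  \<open>c\<^sub>i \<ge> 2\<close> for \<open>i < k\<close>, minimality means that all \<open>c\<^sub>i \<le> 3\<close> with equality at least once; \<open>c\<^sub>i \<ge> 3\<close> says
  that 415263 occurs at \<open>y\<^sub>i\<close>, and \<open>c\<^sub>i \<ge> 4\<close> that it occurs with a gap.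
\<close>

section \<open>Length and the right weak order\<close>

definition inversions :: "nat \<Rightarrow> (nat \<Rightarrow> nat) \<Rightarrow> (nat \<times> nat) set" where
  "inversions n w = {(i, j). 1 \<le> i \<and> i < j \<and> j \<le> n \<and> w j < w i}"

lemma finite_inversions: "finite (inversions n w)"
  by (rule finite_subset[of _ "{1..n} \<times> {1..n}"]) (auto simp: inversions_def)

lemma simple_refl_simps [simp]:
  "simple_refl i i = i + 1" "simple_refl i (Suc i) = i"
  "j \<noteq> i \<Longrightarrow> j \<noteq> Suc i \<Longrightarrow> simple_refl i j = j"
  by (auto simp: simple_refl_def transpose_def)

lemma simple_refl_permutes: "i \<in> {1..<n} \<Longrightarrow> simple_refl i permutes {1..n}"
  unfolding simple_refl_def by (rule permutes_swap_id) auto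

lemma simple_refl_involutory [simp]: "simple_refl i \<circ> simple_refl i = id"
  by (auto simp: simple_refl_def fun_eq_iff)

lemma simple_refl_involutory_app [simp]: "simple_refl i (simple_refl i j) = j"
  by (auto simp: simple_refl_def)

lemma inj_simple_refl: "inj (simple_refl i)"
  by (simp add: simple_refl_def)

lemma comp_simple_refl_cancel [simp]: "w \<circ> simple_refl i \<circ> simple_refl i = w"
  by (simp add: comp_assoc)

lemma simple_refl_strict_mono:
  "p < q \<Longrightarrow> \<not> (p = i \<and> q = Suc i) \<Longrightarrow> simple_refl i p < simple_refl i q"
  by (auto simp: simple_refl_def transpose_def)

text \<open>Swapping adjacent positions keeps the order of every pair of positions except
  \<open>(i, Suc i)\<close>, so relabelling carries old inversions to inversions and only that pair
  is new.\<close>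

lemma inversions_comp_ascent:
  assumes "i \<in> {1..<n}" "w i < w (Suc i)"
  shows "inversions n (w \<circ> simple_refl i) =
    insert (i, Suc i) (map_prod (simple_refl i) (simple_refl i) ` inversions n w)"
    (is "?L = insert _ (?f ` _)")
proof -
  have range: "simple_refl i j \<in> {1..n} \<longleftrightarrow> j \<in> {1..n}" for j
    using permutes_in_image[OF simple_refl_permutes[OF assms(1)]] .
  have inv: "(simple_refl i p, simple_refl i q) \<in> inversions n w"
    if "(p, q) \<in> ?L" "(p, q) \<noteq> (i, Suc i)" for p q
    using that simple_refl_strict_mono[of p q i] range[of p] range[of q]
    by (auto simp: inversions_def)
  have inv': "(simple_refl i p, simple_refl i q) \<in> ?L" if "(p, q) \<in> inversions n w" for p q
  proof -
    have "\<not> (p = i \<and> q = Suc i)" using that assms(2) by (auto simp: inversions_def)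
    then show ?thesis
      using that simple_refl_strict_mono[of p q i] range[of p] range[of q]
      by (auto simp: inversions_def)
  qed
  have top: "(i, Suc i) \<in> ?L"
    using assms by (auto simp: inversions_def)
  show ?thesis
  proof (intro equalityI subsetI)
    fix z assume z: "z \<in> ?L"
    obtain p q where pq: "z = (p, q)" by fastforce
    show "z \<in> insert (i, Suc i) (?f ` inversions n w)"
    proof (cases "z = (i, Suc i)")
      case False
      have "z = ?f (simple_refl i p, simple_refl i q)" by (simp add: pq)
      moreover have "(simple_refl i p, simple_refl i q) \<in> inversions n w"
        using inv[of p q] z False pq by simp
      ultimately show ?thesis by (metis image_eqI insertI2)
    qed simp
  next
    fix z assume "z \<in> insert (i, Suc i) (?f ` inversions n w)"
    then show "z \<in> ?L" using inv' top by auto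
  qed
qed

lemma card_inversions_comp_ascent:
  assumes "i \<in> {1..<n}" "w i < w (Suc i)"
  shows "card (inversions n (w \<circ> simple_refl i)) = Suc (card (inversions n w))"
proof -
  have "inj_on (map_prod (simple_refl i) (simple_refl i)) (inversions n w)"
    using inj_simple_refl by (meson inj_on_subset prod.inj_map subset_UNIV)
  moreover have "(i, Suc i) \<notin> map_prod (simple_refl i) (simple_refl i) ` inversions n w"
  proof
    assume "(i, Suc i) \<in> map_prod (simple_refl i) (simple_refl i) ` inversions n w"
    then obtain p q where "(p, q) \<in> inversions n w" "simple_refl i p = i" "simple_refl i q = Suc i"
      by auto
    moreover from this have "p = Suc i" "q = i"
      using simple_refl_involutory_app[of i p] simple_refl_involutory_app[of i q] by simp_all
    ultimately show False by (auto simp: inversions_def)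
  qed
  ultimately show ?thesis
    by (simp add: inversions_comp_ascent[OF assms] finite_inversions card_image)
qed

lemma card_inversions_comp_descent:
  assumes "i \<in> {1..<n}" "w (Suc i) < w i"
  shows "card (inversions n w) = Suc (card (inversions n (w \<circ> simple_refl i)))"
  using card_inversions_comp_ascent[of i n "w \<circ> simple_refl i"] assms by simp

lemma permutes_inj_eq: "w permutes S \<Longrightarrow> w i = w j \<longleftrightarrow> i = j"
  by (simp add: permutes_inj inj_eq)

lemma word_prod_snoc: "word_prod (is @ [i]) = word_prod is \<circ> simple_refl i"
  by (induction "is") (auto simp: word_prod_def comp_assoc)

lemma word_prod_permutes: "set is \<subseteq> {1..<n} \<Longrightarrow> word_prod is permutes {1..n}"
proof (induction "is" rule: rev_induct)
  case Nil
  then show ?case using permutes_id[of "{1..n}"] by (simp add: word_prod_def id_def)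
next
  case (snoc i "is")
  then show ?case
    by (simp only: word_prod_snoc) (intro permutes_compose simple_refl_permutes; simp)
qed

text \<open>Each letter changes the number of inversions by one; this is the lower bound for the
  Coxeter length.\<close>

lemma card_inversions_word_prod_le:
  "set is \<subseteq> {1..<n} \<Longrightarrow> card (inversions n (word_prod is)) \<le> length is"
proof (induction "is" rule: rev_induct)
  case Nil
  have "inversions n (word_prod []) = {}" by (auto simp: word_prod_def inversions_def)
  then show ?case by simp
next
  case (snoc i "is")
  let ?u = "word_prod is"
  have i: "i \<in> {1..<n}" and le: "card (inversions n ?u) \<le> length is" using snoc by auto
  have "?u i \<noteq> ?u (Suc i)"
    using permutes_inj_eq[OF word_prod_permutes, of "is" n] snoc by auto
  then have "card (inversions n (?u \<circ> simple_refl i)) \<le> Suc (card (inversions n ?u))"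
    using card_inversions_comp_ascent[OF i, of ?u] card_inversions_comp_descent[OF i, of ?u]
    by linarith
  then show ?case using le by (simp add: word_prod_snoc comp_def)
qed

lemma ascending_on_interval:
  fixes w :: "nat \<Rightarrow> nat"
  assumes "\<And>i. a \<le> i \<Longrightarrow> i < b \<Longrightarrow> w i < w (Suc i)" "a \<le> i" "i < j" "j \<le> b"
  shows "w i < w j"
  using assms(3,4)
proof (induction j)
  case (Suc j)
  then show ?case using assms(1)[of j] assms(2) by (cases "i = j") auto
qed simp

text \<open>Positions below \<open>a\<close> and positions from \<open>a\<close> on keep to their
  own values, so an entry of the block \<open>[a, m)\<close>, being smaller than everything after
  it, takes the least value still free. The block is everything, the part before the chain of
  descents, or the part after it.\<close>

lemma permutes_increasing_eq_id:
  fixes w :: "nat \<Rightarrow> nat"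
  assumes w: "w permutes {1..n}"
    and less: "\<And>i j. a \<le> i \<Longrightarrow> i < m \<Longrightarrow> i < j \<Longrightarrow> j \<le> n \<Longrightarrow> w i < w j"
    and low: "\<And>i. 1 \<le> i \<Longrightarrow> i < a \<Longrightarrow> w i < a"
    and high: "\<And>i. a \<le> i \<Longrightarrow> i \<le> n \<Longrightarrow> a \<le> w i"
    and "m \<le> Suc n" "1 \<le> a" "a \<le> i" "i < m"
  shows "w i = i"
  using assms(7,8)
proof (induction i rule: less_induct)
  case (less i)
  have inj: "w x = w y \<longleftrightarrow> x = y" for x y using permutes_inj_eq[OF w] .
  have range: "w x \<in> {1..n} \<longleftrightarrow> x \<in> {1..n}" for x using permutes_in_image[OF w] .
  have i: "i \<in> {1..n}" using less.prems assms(5,6) by auto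
  have "w i \<ge> i"
  proof (rule ccontr)
    assume "\<not> i \<le> w i"
    then show False using less.IH[of "w i"] less.prems inj[of "w i" i] high[of i] i by auto
  qed
  moreover have "\<not> i < w i"
  proof
    assume lt: "i < w i"
    obtain j where j: "w j = i" using permutes_surj[OF w] by (metis surjD)
    have jr: "j \<in> {1..n}" using range[of j] i j by simp
    have "j \<noteq> i" using lt j by auto
    moreover have "\<not> j < i" using less.IH[of j] less.prems low[of j] jr j by fastforce
    ultimately have "i < j" by simp
    then show False using assms(2)[of i j] less.prems jr j lt by auto
  qed
  ultimately show ?case by simp
qed

lemma ex_descent:
  assumes "w permutes {1..n}" "w \<noteq> id"
  shows "\<exists>i\<in>{1..<n}. w (Suc i) < w i"
proof (rule ccontr)
  assume "\<not> ?thesis"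
  then have step: "w i < w (Suc i)" if "1 \<le> i" "i < n" for i
    using permutes_inj_eq[OF assms(1), of i "Suc i"] that by (meson atLeastLessThan_iff linorder_neqE_nat n_not_Suc_n)
  have mono: "w i < w j" if "1 \<le> i" "i < j" "j \<le> n" for i j
    using ascending_on_interval[of 1 n w, OF step that] .
  have "w i = i" for i
  proof (cases "i \<in> {1..n}")
    case True
    have "1 \<le> w j" if "1 \<le> j" "j \<le> n" for j
      using permutes_in_image[OF assms(1), of j] that by auto
    then show ?thesis
      using permutes_increasing_eq_id[OF assms(1), of 1 "Suc n" i] mono True by auto
  next
    case False
    then show ?thesis using assms(1) by (auto simp: permutes_def)
  qed
  then show False using assms(2) by auto
qed

text \<open>Sorting by undoing descents costs one inversion per letter, so the lower bound is
  attained.\<close>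

lemma ex_word_prod_eq:
  assumes "w permutes {1..n}"
  shows "\<exists>is. length is = card (inversions n w) \<and> set is \<subseteq> {1..<n} \<and> word_prod is = w"
  using assms
proof (induction "card (inversions n w)" arbitrary: w rule: less_induct)
  case less
  show ?case
  proof (cases "w = id")
    case True
    have "inversions n w = {}" by (auto simp: True inversions_def)
    then have "card (inversions n w) = 0" by simp
    then show ?thesis by (intro exI[of _ "[]"]) (auto simp: True word_prod_def)
  next
    case False
    then obtain i where i: "i \<in> {1..<n}" "w (Suc i) < w i" using ex_descent less.prems by blast
    let ?u = "w \<circ> simple_refl i"
    have card: "card (inversions n w) = Suc (card (inversions n ?u))"
      using card_inversions_comp_descent[of i n w] i by blast
    moreover have "?u permutes {1..n}"
      using simple_refl_permutes[OF i(1)] less.prems by (rule permutes_compose)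
    ultimately obtain "is" where "is": "length is = card (inversions n ?u)" "set is \<subseteq> {1..<n}"
      "word_prod is = ?u" using less.hyps[of ?u] by auto
    then show ?thesis using i card by (intro exI[of _ "is @ [i]"]) (auto simp: word_prod_snoc)
  qed
qed

lemma coxeter_length_eq_card_inversions:
  assumes "w permutes {1..n}"
  shows "coxeter_length n w = card (inversions n w)"
  unfolding coxeter_length_def
proof (rule Least_equality)
  show "\<exists>is. length is = card (inversions n w) \<and> set is \<subseteq> {1..<n} \<and> word_prod is = w"
    using ex_word_prod_eq[OF assms] .
qed (use card_inversions_word_prod_le in blast)

text \<open>By the inversion count the length grows exactly when \<open>i\<close> is a descent of
  the larger element, so the steps down from \<open>w\<close> are the removals of single
  descents.\<close>

lemma right_weak_step_iff:
  "right_weak_step n u w \<longleftrightarrow>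
     w permutes {1..n} \<and> (\<exists>i\<in>descents n w. u = w \<circ> simple_refl i)"
proof
  assume "right_weak_step n u w"
  then obtain i where u: "u permutes {1..n}" and i: "i \<in> {1..<n}" and w: "w = u \<circ> simple_refl i"
    and len: "coxeter_length n u < coxeter_length n w" by (auto simp: right_weak_step_def)
  have wp: "w permutes {1..n}"
    unfolding w using simple_refl_permutes[OF i] u by (rule permutes_compose)
  have "card (inversions n u) < card (inversions n w)"
    using len by (simp only: coxeter_length_eq_card_inversions[OF u] coxeter_length_eq_card_inversions[OF wp])
  then have "\<not> u (Suc i) < u i" using card_inversions_comp_descent[OF i, of u] w by auto
  then have "u i < u (Suc i)" using permutes_inj_eq[OF u, of i "Suc i"] by simp
  then have "i \<in> descents n w" using i w by (auto simp: descents_def)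
  then show "w permutes {1..n} \<and> (\<exists>i\<in>descents n w. u = w \<circ> simple_refl i)"
    using wp w comp_simple_refl_cancel[of u i] by metis
next
  assume "w permutes {1..n} \<and> (\<exists>i\<in>descents n w. u = w \<circ> simple_refl i)"
  then obtain i where wp: "w permutes {1..n}" and i: "i \<in> {1..<n}" "w (Suc i) < w i"
    and u: "u = w \<circ> simple_refl i" by (auto simp: descents_def)
  have up: "u permutes {1..n}"
    unfolding u using simple_refl_permutes[OF i(1)] wp by (rule permutes_compose)
  have "coxeter_length n u < coxeter_length n w"
    using card_inversions_comp_descent[of i n w] i
    by (simp only: coxeter_length_eq_card_inversions[OF up] coxeter_length_eq_card_inversions[OF wp] flip: u)
  moreover have "w = u \<circ> simple_refl i" using u by simp
  ultimately show "right_weak_step n u w" using up i(1) unfolding right_weak_step_def by blast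
qed

section \<open>Insertion of 321-avoiding permutations\<close>

text \<open>
  For a 321-avoiding permutation every bumped entry exceeds the whole second row, so Schensted
  insertion is determined by the two sets of entries of the first two rows.
\<close>

definition bump_step :: "nat \<Rightarrow> nat set \<times> nat set \<Rightarrow> nat set \<times> nat set" where
  "bump_step x s =
     (if \<exists>a\<in>fst s. x < a
      then (let m = (LEAST a. a \<in> fst s \<and> x < a) in (insert x (fst s - {m}), insert m (snd s)))
      else (insert x (fst s), snd s))"

primrec two_rows :: "(nat \<Rightarrow> nat) \<Rightarrow> nat \<Rightarrow> nat set \<times> nat set" where
  "two_rows w 0 = ({}, {})"
| "two_rows w (Suc j) = bump_step (w (Suc j)) (two_rows w j)"

text \<open>For a row \<open>A\<close> this is the entry that inserting \<open>x\<close> bumps,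
  stated as a relation to keep \<open>LEAST\<close> out of later arguments.\<close>

definition least_above :: "nat \<Rightarrow> nat set \<Rightarrow> nat \<Rightarrow> bool" where
  "least_above x A m \<longleftrightarrow> m \<in> A \<and> x < m \<and> (\<forall>a\<in>A. x < a \<longrightarrow> m \<le> a)"

lemma bump_step_bump:
  assumes "least_above x A m"
  shows "bump_step x (A, B) = (insert x (A - {m}), insert m B)"
proof -
  have "(LEAST a. a \<in> A \<and> x < a) = m"
    using assms by (intro Least_equality) (auto simp: least_above_def)
  then show ?thesis using assms by (auto simp: bump_step_def least_above_def)
qed

lemma bump_step_append: "\<forall>a\<in>A. a \<le> x \<Longrightarrow> bump_step x (A, B) = (insert x A, B)"
  by (auto simp: bump_step_def not_less[symmetric])

lemma least_above_cases:
  obtains "\<forall>a\<in>A. a \<le> x" | m where "least_above x A m"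
proof (cases "\<exists>a. a \<in> A \<and> x < a")
  case True
  then have "least_above x A (LEAST a. a \<in> A \<and> x < a)"
    unfolding least_above_def by (metis (mono_tags, lifting) LeastI_ex Least_le)
  then show ?thesis using that by blast
next
  case False
  then show ?thesis using that by (meson not_less)
qed

section \<open>Avoidance of 321 and its stability under removing a descent\<close>

definition avoids_321 :: "nat \<Rightarrow> (nat \<Rightarrow> nat) \<Rightarrow> bool" where
  "avoids_321 n w \<longleftrightarrow>
     (\<forall>p q r. 1 \<le> p \<longrightarrow> p < q \<longrightarrow> q < r \<longrightarrow> r \<le> n \<longrightarrow> w r < w q \<longrightarrow> \<not> w q < w p)"

lemma contains_321_iff: "contains_pattern n w [3, 2, 1] \<longleftrightarrow> \<not> avoids_321 n w"
proof
  assume "contains_pattern n w [3, 2, 1]"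
  then obtain ps where occ: "occurrence n w [3, 2, 1] ps"
    by (auto simp: contains_pattern_def)
  then have ps: "length ps = 3" "sorted_wrt (<) ps" "set ps \<subseteq> {1..n}"
    "\<And>i j. i < 3 \<Longrightarrow> j < 3 \<Longrightarrow> w (ps ! i) < w (ps ! j) \<longleftrightarrow> [3, 2, 1 :: nat] ! i < [3, 2, 1] ! j"
    by (simp_all add: occurrence_def)
  then obtain p q r where pqr: "ps = [p, q, r]"
    by (auto simp: numeral_3_eq_3 length_Suc_conv)
  have "w r < w q" "w q < w p" using ps(4)[of 2 1] ps(4)[of 1 0] by (auto simp: pqr)
  then show "\<not> avoids_321 n w" using ps(2,3) by (fastforce simp: pqr avoids_321_def)
next
  assume "\<not> avoids_321 n w"
  then obtain p q r where "1 \<le> p" "p < q" "q < r" "r \<le> n" "w r < w q" "w q < w p"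
    by (auto simp: avoids_321_def)
  then have "occurrence n w [3, 2, 1] [p, q, r]"
    by (auto simp: occurrence_def less_Suc_eq numeral_3_eq_3)
  then show "contains_pattern n w [3, 2, 1]" by (auto simp: contains_pattern_def)
qed

lemma fully_commutative_iff: "fully_commutative n w \<longleftrightarrow> w permutes {1..n} \<and> avoids_321 n w"
  by (simp only: fully_commutative_def contains_321_iff not_not)

text \<open>After the swap the positions \<open>i\<close> and \<open>Suc i\<close> carry an ascent,
  so no inverted pair of a 321 is \<open>(i, Suc i)\<close>; hence \<open>simple_refl i\<close>
  keeps the order of its three positions and transports it to \<open>w\<close>.\<close>

lemma fully_commutative_comp_descent:
  assumes "fully_commutative n w" "i \<in> descents n w"
  shows "fully_commutative n (w \<circ> simple_refl i)"
proof -
  have i: "i \<in> {1..<n}" "w (Suc i) < w i" using assms(2) by (auto simp: descents_def)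
  have w: "w permutes {1..n}" "avoids_321 n w" using assms(1) by (auto simp: fully_commutative_iff)
  have range: "simple_refl i j \<in> {1..n} \<longleftrightarrow> j \<in> {1..n}" for j
    using permutes_in_image[OF simple_refl_permutes[OF i(1)]] .
  have "avoids_321 n (w \<circ> simple_refl i)"
    unfolding avoids_321_def
  proof (intro allI impI notI)
    fix p q r
    assume *: "1 \<le> p" "p < q" "q < r" "r \<le> n"
      "(w \<circ> simple_refl i) r < (w \<circ> simple_refl i) q" "(w \<circ> simple_refl i) q < (w \<circ> simple_refl i) p"
    then have "simple_refl i p < simple_refl i q" "simple_refl i q < simple_refl i r"
      using i(2) by (auto intro!: simple_refl_strict_mono)
    moreover have "simple_refl i p \<in> {1..n}" "simple_refl i r \<in> {1..n}"
      unfolding range using * by auto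
    ultimately show False using w(2) * unfolding avoids_321_def comp_apply
      by (metis atLeastAtMost_iff)
  qed
  then show ?thesis
    using permutes_compose[OF simple_refl_permutes[OF i(1)] w(1)] by (simp only: fully_commutative_iff)
qed

lemma row_insert_append:
  "\<forall>a\<in>set r. a \<le> x \<Longrightarrow> row_insert x r = (r @ [x], None)"
  by (induction r) (auto simp: not_less)

lemma row_insert_bump:
  assumes "sorted_wrt (<) r" "least_above x (set r) m" "x \<notin> set r"
  shows "\<exists>r'. row_insert x r = (r', Some m) \<and> sorted_wrt (<) r' \<and> set r' = insert x (set r - {m})"
  using assms
proof (induction r)
  case Nil
  then show ?case by (simp add: least_above_def)
next
  case (Cons y ys)
  show ?case
  proof (cases "x < y")
    case True
    have "y = m" using Cons.prems True by (fastforce simp: least_above_def)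
    then show ?thesis using Cons.prems True by (fastforce simp: least_above_def)
  next
    case False
    then have "y < x" using Cons.prems by auto
    moreover from this have "least_above x (set ys) m" using Cons.prems by (auto simp: least_above_def)
    then obtain r' where r': "row_insert x ys = (r', Some m)" "sorted_wrt (<) r'"
      "set r' = insert x (set ys - {m})" using Cons by auto
    moreover have "m \<noteq> y" using \<open>y < x\<close> Cons.prems by (auto simp: least_above_def)
    ultimately show ?thesis using Cons.prems False by auto
  qed
qed

text \<open>Strict sortedness lets a row be recovered from its set. The conditional reflects that a
  tableau stores no empty rows and that no third row arises.\<close>

definition represents :: "nat list list \<Rightarrow> nat set \<times> nat set \<Rightarrow> bool" where
  "represents T s \<longleftrightarrow>
     (\<exists>r t. sorted_wrt (<) r \<and> sorted_wrt (<) t \<and> fst s = set r \<and> snd s = set t \<and>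
        T = (if r = [] then [] else if t = [] then [r] else [r, t]) \<and> (r = [] \<longrightarrow> t = []))"

lemma row2_represents: "represents T s \<Longrightarrow> row2 T = snd s"
  unfolding represents_def row2_def by (elim exE conjE) (simp split: if_splits)

text \<open>By \<open>above\<close>, the bumped entry is appended to the second row, so nothing is
  bumped into a third.\<close>

lemma represents_tableau_insert:
  assumes T: "represents T (A, B)" and x: "x \<notin> A"
    and above: "\<And>m b. least_above x A m \<Longrightarrow> b \<in> B \<Longrightarrow> b < m"
  shows "represents (tableau_insert x T) (bump_step x (A, B))"
proof -
  obtain r t where rt: "sorted_wrt (<) r" "sorted_wrt (<) t" "A = set r" "B = set t"
    "T = (if r = [] then [] else if t = [] then [r] else [r, t])" "r = [] \<longrightarrow> t = []"
    using T by (auto simp: represents_def)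
  show ?thesis
  proof (cases rule: least_above_cases[of A x])
    case 1
    then have ins: "row_insert x r = (r @ [x], None)" using rt(3) by (simp add: row_insert_append)
    have "sorted_wrt (<) (r @ [x])" using rt 1 x by (auto simp: sorted_wrt_append order_le_less)
    then have "represents (if t = [] then [r @ [x]] else [r @ [x], t]) (insert x A, B)"
      unfolding represents_def using rt by (intro exI[of _ "r @ [x]"] exI[of _ t]) auto
    then show ?thesis using rt ins 1 by (auto simp: bump_step_append)
  next
    case (2 m)
    then obtain r' where r': "row_insert x r = (r', Some m)" "sorted_wrt (<) r'"
      "set r' = insert x (set r - {m})" using row_insert_bump[OF rt(1), of x m] rt x by auto
    have "r \<noteq> []" using 2 rt by (auto simp: least_above_def)
    have "r' \<noteq> []" using r'(3) by auto
    have lt: "\<forall>b\<in>set t. b < m" using above 2 rt by auto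
    then have "row_insert m t = (t @ [m], None)" by (simp add: row_insert_append less_imp_le)
    then have ins: "tableau_insert x T = [r', t @ [m]]" using \<open>r \<noteq> []\<close> rt r' by auto
    have "sorted_wrt (<) (t @ [m])" using rt lt by (auto simp: sorted_wrt_append)
    then have "represents [r', t @ [m]] (insert x (A - {m}), insert m B)"
      unfolding represents_def using r'(2,3) rt(3,4) \<open>r' \<noteq> []\<close>
      by (intro exI[of _ r'] exI[of _ "t @ [m]"]) simp
    then show ?thesis using ins 2 by (simp add: bump_step_bump)
  qed
qed

lemma two_rows_subset: "fst (two_rows w j) \<union> snd (two_rows w j) \<subseteq> w ` {1..j}"
proof (induction j)
  case (Suc j)
  obtain A B where AB: "two_rows w j = (A, B)" by fastforce
  have "w ` {1..j} \<subseteq> w ` {1..Suc j}" by auto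
  moreover have "w (Suc j) \<in> w ` {1..Suc j}" by auto
  ultimately show ?case
    using Suc by (cases rule: least_above_cases[of A "w (Suc j)"])
      (auto simp: AB bump_step_append bump_step_bump least_above_def)
qed simp

lemma two_rows_entry:
  "c \<in> fst (two_rows w j) \<union> snd (two_rows w j) \<Longrightarrow> \<exists>p. 1 \<le> p \<and> p \<le> j \<and> w p = c"
  using two_rows_subset[of w j] by fastforce

lemma two_rows_cong: "(\<And>i. 1 \<le> i \<Longrightarrow> i \<le> j \<Longrightarrow> v i = w i) \<Longrightarrow> two_rows v j = two_rows w j"
  by (induction j) auto

lemma two_rows_eq_extend:
  assumes "two_rows v j = two_rows w j" "\<And>i. j < i \<Longrightarrow> i \<le> l \<Longrightarrow> v i = w i" "j \<le> l"
  shows "two_rows v l = two_rows w l"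
  using assms(3,2)
proof (induction l rule: dec_induct)
  case base
  then show ?case using assms(1) by simp
next
  case (step l)
  then show ?case by simp
qed

lemma last_letter_in_two_rows: "1 \<le> j \<Longrightarrow> w j \<in> fst (two_rows w j)"
proof (cases j)
  case (Suc i)
  obtain A B where AB: "two_rows w i = (A, B)" by fastforce
  show ?thesis
    by (cases rule: least_above_cases[of A "w (Suc i)"])
      (auto simp: AB Suc bump_step_append bump_step_bump)
qed simp

lemma two_rows_disjoint:
  assumes "inj w"
  shows "fst (two_rows w j) \<inter> snd (two_rows w j) = {}"
proof (induction j)
  case (Suc j)
  obtain A B where AB: "two_rows w j = (A, B)" by fastforce
  have "w (Suc j) \<notin> A \<union> B"
    using two_rows_subset[of w j] assms by (auto simp: AB inj_eq)
  then show ?case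
    using Suc by (cases rule: least_above_cases[of A "w (Suc j)"])
      (auto simp: AB bump_step_append bump_step_bump least_above_def)
qed simp

text \<open>When a letter \<open>x\<close> bumps \<open>b\<close>, no first-row entry lies strictly
  between them, so \<open>a <= x\<close> and the positions of \<open>b\<close> and \<open>x\<close>
  form the inversion; if \<open>a\<close> is read later, it is itself the lower letter. Any still
  later letter below \<open>a\<close> would complete a 321.\<close>

lemma two_rows_small_first_entry:
  assumes "b \<in> snd (two_rows w j)" "a \<in> fst (two_rows w j)" "a < b"
  shows "\<exists>p q. 1 \<le> p \<and> p < q \<and> q \<le> j \<and> w q < w p \<and> a \<le> w q"
  using assms
proof (induction j arbitrary: a b)
  case (Suc j)
  obtain A B where AB: "two_rows w j = (A, B)" by fastforce
  let ?x = "w (Suc j)"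
  have sub: "\<exists>p. 1 \<le> p \<and> p \<le> j \<and> w p = c" if "c \<in> A \<union> B" for c
    using two_rows_entry[of c w j] that by (simp add: AB)
  have old: ?case if "a \<in> A" "b \<in> B"
    using Suc.IH[of b a] that Suc.prems by (fastforce simp: AB)
  have new: ?case if b: "b \<in> A \<union> B" and x: "a \<le> ?x" "?x < b"
  proof -
    obtain p where "1 \<le> p" "p \<le> j" "w p = b" using sub b by blast
    then show ?thesis using x by (intro exI[of _ p] exI[of _ "Suc j"]) auto
  qed
  show ?case
  proof (cases rule: least_above_cases[of A ?x])
    case 1
    then have "a \<in> insert ?x A" "b \<in> B" using Suc.prems by (auto simp: AB bump_step_append)
    then show ?thesis using old new Suc.prems by blast
  next
    case (2 m)
    then have ab: "a \<in> insert ?x (A - {m})" "b \<in> insert m B"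
      using Suc.prems by (auto simp: AB bump_step_bump)
    have m: "m \<in> A" "?x < m" and least: "\<And>c. c \<in> A \<Longrightarrow> ?x < c \<Longrightarrow> m \<le> c"
      using 2 by (auto simp: least_above_def)
    show ?thesis
    proof (cases "b = m")
      case True
      then have "a \<le> ?x" using least[of a] ab Suc.prems by (auto simp: not_less[symmetric])
      then show ?thesis using new True m by auto
    next
      case False
      then show ?thesis using ab old new Suc.prems by blast
    qed
  qed
qed simp

lemma represents_insertion_tableau:
  assumes "fully_commutative n w" "j \<le> n"
  shows "represents (insertion_tableau j w) (two_rows w j)"
  using assms(2)
proof (induction j)
  case 0
  then show ?case by (simp add: insertion_tableau_def represents_def)
next
  case (Suc j)
  obtain A B where AB: "two_rows w j = (A, B)" by fastforce
  have w: "w permutes {1..n}" "avoids_321 n w" using assms(1) by (auto simp: fully_commutative_iff)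
  have "w (Suc j) \<notin> A"
    using two_rows_subset[of w j] permutes_inj_eq[OF w(1)] by (auto simp: AB)
  \<comment> \<open>Otherwise the second row would witness an inversion with both values at least
    \<open>m\<close>, and the new letter, being below \<open>m\<close>, would complete it to a
    321.\<close>
  moreover have "b < m" if "least_above (w (Suc j)) A m" "b \<in> B" for m b
  proof (rule ccontr)
    have bm: "b \<in> B" "m \<in> A" using that by (auto simp: least_above_def)
    assume "\<not> b < m"
    moreover have "b \<noteq> m"
      using two_rows_disjoint[OF permutes_inj[OF w(1)], of j] that by (auto simp: AB least_above_def)
    ultimately have "m < b" by simp
    then obtain p q where "1 \<le> p" "p < q" "q \<le> j" "w q < w p" "m \<le> w q"
      using two_rows_small_first_entry[of b w j m] bm AB by auto
    moreover have "w (Suc j) < m" using that by (simp add: least_above_def)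
    ultimately show False using w(2) Suc.prems unfolding avoids_321_def
      by (metis le_imp_less_Suc order_less_le_trans)
  qed
  ultimately have "represents (tableau_insert (w (Suc j)) (insertion_tableau j w)) (two_rows w (Suc j))"
    using represents_tableau_insert[of "insertion_tableau j w" A B "w (Suc j)"] Suc by (simp add: AB)
  then show ?case by (simp add: insertion_tableau_def)
qed

lemma row2_insertion_tableau:
  "fully_commutative n w \<Longrightarrow> row2 (insertion_tableau n w) = snd (two_rows w n)"
  using represents_insertion_tableau row2_represents by blast

section \<open>Removing a descent\<close>

text \<open>The invariant for running two insertions in parallel: \<open>s\<close> belongs to
  \<open>w\<close>, and \<open>t\<close> to \<open>w\<close> with a descent removed, where
  \<open>z\<close> still waits in the first row.\<close>

definition entry_lifted :: "nat \<Rightarrow> nat set \<times> nat set \<Rightarrow> nat set \<times> nat set \<Rightarrow> bool" where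
  "entry_lifted z s t \<longleftrightarrow> z \<notin> fst s \<and> fst t = insert z (fst s) \<and> snd s = insert z (snd t)"

lemma entry_lifted_iff:
  "entry_lifted z (A, B) (C, E) \<longleftrightarrow> z \<notin> A \<and> C = insert z A \<and> B = insert z E"
  by (simp add: entry_lifted_def)

lemma entry_lifted_below:
  assumes "entry_lifted z (A, B) (C, E)" "z < x"
  shows "entry_lifted z (bump_step x (A, B)) (bump_step x (C, E))"
proof (cases rule: least_above_cases[of A x])
  case 1
  moreover have "\<forall>a\<in>C. a \<le> x" using 1 assms by (auto simp: entry_lifted_iff)
  ultimately show ?thesis
    using assms unfolding bump_step_append[OF 1] bump_step_append[OF \<open>\<forall>a\<in>C. a \<le> x\<close>]
    by (auto simp: entry_lifted_iff)
next
  case (2 m)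
  then have m: "least_above x C m" using assms by (auto simp: least_above_def entry_lifted_iff)
  show ?thesis
    using assms 2 unfolding bump_step_bump[OF 2] bump_step_bump[OF m]
    by (auto simp: entry_lifted_iff least_above_def)
qed

text \<open>State \<open>t\<close> bumps \<open>z\<close> while \<open>s\<close> bumps
  \<open>m\<close>. Now both second rows contain \<open>z\<close>, and \<open>m\<close> takes over
  its role.\<close>

lemma entry_lifted_bump:
  assumes "entry_lifted z (A, B) (C, E)" "x < z" and m: "least_above x A m" and "z < m"
  shows "entry_lifted m (bump_step x (A, B)) (bump_step x (C, E))"
proof -
  have z: "least_above x C z" using assms by (auto simp: least_above_def entry_lifted_iff)
  show ?thesis
    using assms unfolding bump_step_bump[OF m] bump_step_bump[OF z]
    by (auto simp: entry_lifted_iff least_above_def)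
qed

lemma entry_lifted_bump_other:
  assumes "entry_lifted z (A, B) (C, E)" "x < z" and m: "least_above x A m" and "m < z"
  shows "entry_lifted z (bump_step x (A, B)) (bump_step x (C, E))"
proof -
  have m': "least_above x C m" using assms by (auto simp: least_above_def entry_lifted_iff)
  show ?thesis
    using assms unfolding bump_step_bump[OF m] bump_step_bump[OF m']
    by (auto simp: entry_lifted_iff least_above_def)
qed

text \<open>State \<open>t\<close> bumps \<open>z\<close> while \<open>s\<close> merely appends, so
  the difference disappears for good.\<close>

lemma entry_lifted_drop:
  assumes "entry_lifted z (A, B) (C, E)" "x < z" and A: "\<forall>a\<in>A. a \<le> x"
  shows "bump_step x (A, B) = bump_step x (C, E)"
proof -
  have z: "least_above x C z" using assms by (auto simp: least_above_def entry_lifted_iff)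
  show ?thesis
    using assms unfolding bump_step_append[OF A] bump_step_bump[OF z] by (auto simp: entry_lifted_iff)
qed

lemma entry_lifted_step:
  assumes "entry_lifted z s t" "x \<noteq> z"
  shows "bump_step x s = bump_step x t \<or> (\<exists>z. entry_lifted z (bump_step x s) (bump_step x t))"
proof -
  obtain A B C E where st: "s = (A, B)" "t = (C, E)" by fastforce
  note lifted = assms(1)[unfolded st]
  show ?thesis
  proof (cases "z < x")
    case True
    then show ?thesis using entry_lifted_below[OF lifted] st by blast
  next
    case False
    then have less: "x < z" using assms by simp
    show ?thesis
    proof (cases rule: least_above_cases[of A x])
      case 1
      then show ?thesis using entry_lifted_drop[OF lifted less] st by simp
    next
      case (2 m)
      have "z \<noteq> m" using 2 lifted by (auto simp: least_above_def entry_lifted_iff)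
      then show ?thesis
        using entry_lifted_bump[OF lifted less 2] entry_lifted_bump_other[OF lifted less 2] st
        by (meson linorder_neqE_nat)
    qed
  qed
qed

section \<open>Comparing the insertions of \<open>w\<close> and of \<open>w\<close> with one descent
  removed\<close>

locale fc_perm =
  fixes n :: nat and w :: "nat \<Rightarrow> nat"
  assumes fc: "fully_commutative n w"
begin

lemma perm: "w permutes {1..n}"
  using fc by (simp add: fully_commutative_def)

lemma no_321: "1 \<le> p \<Longrightarrow> p < q \<Longrightarrow> q < r \<Longrightarrow> r \<le> n \<Longrightarrow> w r < w q \<Longrightarrow> w p < w q"
  using fc permutes_inj_eq[OF perm, of p q]
  by (auto simp: fully_commutative_iff avoids_321_def) (meson linorder_neqE_nat)

lemma w_inj: "w i = w j \<longleftrightarrow> i = j"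
  using permutes_inj_eq[OF perm] .

lemma w_range: "w i \<in> {1..n} \<longleftrightarrow> i \<in> {1..n}"
  using permutes_in_image[OF perm] .

lemma descents_iff: "i \<in> descents n w \<longleftrightarrow> 1 \<le> i \<and> i < n \<and> w (Suc i) < w i"
  by (auto simp: descents_def)

text \<open>With no first-row entry between the two letters, 321-avoidance puts the whole first row
  below both. Then \<open>w\<close> bumps the descent top at once, whereas \<open>v\<close> appends
  both letters.\<close>

lemma two_rows_descent_states:
  assumes i: "Suc j \<in> descents n w" and s: "two_rows w j = (A, B)"
    and gap: "\<And>c. c \<in> A \<Longrightarrow> w (Suc (Suc j)) < c \<Longrightarrow> w (Suc j) \<le> c"
  defines "v \<equiv> w \<circ> simple_refl (Suc j)"
  shows "two_rows w (Suc (Suc j)) = (insert (w (Suc (Suc j))) A, insert (w (Suc j)) B)"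
    and "two_rows v (Suc (Suc j)) = (insert (w (Suc (Suc j))) (insert (w (Suc j)) A), B)"
    and "\<forall>c\<in>A. c < w (Suc (Suc j))"
    and "entry_lifted (w (Suc j)) (two_rows w (Suc (Suc j))) (two_rows v (Suc (Suc j)))"
proof -
  let ?b = "w (Suc j)" and ?a = "w (Suc (Suc j))"
  have ab: "?a < ?b" "Suc (Suc j) \<le> n" using i by (auto simp: descents_iff)
  have sub: "\<exists>p. 1 \<le> p \<and> p \<le> j \<and> w p = c" if "c \<in> A \<union> B" for c
    using two_rows_entry[of c w j] that by (simp add: s)
  have bA: "?b \<notin> A \<union> B" and aA: "?a \<notin> A \<union> B"
    using sub[of ?b] sub[of ?a] by (auto simp: w_inj)
  have small: "c < ?a" if "c \<in> A" for c
  proof (rule ccontr)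
    assume "\<not> c < ?a"
    moreover have "c \<noteq> ?a" "c \<noteq> ?b" using that aA bA by auto
    ultimately have "?b < c" using gap[OF that] by linarith
    moreover obtain p where "1 \<le> p" "p \<le> j" "w p = c" using sub[of c] \<open>c \<in> A\<close> by blast
    ultimately show False using no_321[of p "Suc j" "Suc (Suc j)"] ab by auto
  qed
  then show "\<forall>c\<in>A. c < ?a" by blast
  have "two_rows w (Suc j) = (insert ?b A, B)"
    using small ab by (force simp: s intro: bump_step_append)
  moreover have "least_above ?a (insert ?b A) ?b"
    using small ab by (force simp: least_above_def)
  ultimately show w: "two_rows w (Suc (Suc j)) = (insert ?a A, insert ?b B)"
    using bA by (simp add: bump_step_bump)
  have "two_rows v j = (A, B)" using two_rows_cong[of j v w] s by (simp add: v_def)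
  then have "two_rows v (Suc j) = (insert ?a A, B)"
    using small by (force simp: v_def intro: bump_step_append)
  then have "two_rows v (Suc (Suc j)) = (insert ?b (insert ?a A), B)"
    using small ab by (force simp: v_def intro: bump_step_append)
  then show v: "two_rows v (Suc (Suc j)) = (insert ?a (insert ?b A), B)"
    by (simp add: insert_commute)
  show "entry_lifted ?b (two_rows w (Suc (Suc j))) (two_rows v (Suc (Suc j)))"
    unfolding w v using bA ab by (auto simp: entry_lifted_def)
qed

text \<open>As in a Knuth relation, an entry between the two letters hides the swap: in either order
  the smaller letter bumps the same \<open>m\<close> below \<open>w (Suc j)\<close>, and the larger
  letter sees the same entries above it.\<close>

lemma two_rows_descent_gap:
  assumes i: "Suc j \<in> descents n w" and s: "two_rows w j = (A, B)"
    and c: "c \<in> A" "w (Suc (Suc j)) < c" "c < w (Suc j)"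
  shows "two_rows (w \<circ> simple_refl (Suc j)) (Suc (Suc j)) = two_rows w (Suc (Suc j))"
proof -
  let ?b = "w (Suc j)" and ?a = "w (Suc (Suc j))" and ?v = "w \<circ> simple_refl (Suc j)"
  have ab: "?a < ?b" using i by (auto simp: descents_iff)
  have sub: "\<exists>p. 1 \<le> p \<and> p \<le> j \<and> w p = c" if "c \<in> A \<union> B" for c
    using two_rows_entry[of c w j] that by (simp add: s)
  have bA: "?b \<notin> A \<union> B" and aA: "?a \<notin> A \<union> B"
    using sub[of ?b] sub[of ?a] by (auto simp: w_inj)
  have v: "two_rows ?v (Suc (Suc j)) = bump_step ?b (bump_step ?a (A, B))"
    using two_rows_cong[of j ?v w] s by simp
  obtain m where m: "least_above ?a A m"
    using c by (cases rule: least_above_cases[of A ?a]) auto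
  then have mb: "m < ?b" "m \<in> A" "?a < m" using c by (auto simp: least_above_def)
  show ?thesis
  proof (cases rule: least_above_cases[of A ?b])
    case 1
    have "least_above ?a (insert ?b A) m" using m mb by (auto simp: least_above_def)
    moreover have "\<forall>c\<in>insert ?a (A - {m}). c \<le> ?b" using 1 ab by auto
    ultimately show ?thesis
      unfolding v using 1 m mb by (simp add: s bump_step_append bump_step_bump insert_commute insert_Diff_if)
  next
    case (2 q)
    have "least_above ?a (insert ?b (A - {q})) m" using m mb 2 by (auto simp: least_above_def)
    moreover have "least_above ?b (insert ?a (A - {m})) q" using 2 ab mb by (auto simp: least_above_def)
    moreover have "m \<noteq> ?b" "q \<noteq> ?a" using mb 2 ab by (auto simp: least_above_def)
    ultimately show ?thesis
      unfolding v using 2 m by (auto simp add: s bump_step_bump)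
  qed
qed

text \<open>From \<open>Suc i\<close> on both insertions read the same letters, so their states
  coincide or differ by one lifted entry. Hence crowdedness is inherited upwards in the weak
  order.\<close>

lemma row2_comp_descent_subset:
  assumes "i \<in> descents n w"
  shows "row2 (insertion_tableau n (w \<circ> simple_refl i)) \<subseteq> row2 (insertion_tableau n w)"
proof -
  define v where "v = w \<circ> simple_refl i"
  have v: "v l = w (simple_refl i l)" for l by (simp add: v_def)
  obtain j where j: "i = Suc j" using assms by (cases i) (auto simp: descents_iff)
  have n: "Suc i \<le> n" using assms by (auto simp: descents_iff)
  obtain A B where AB: "two_rows w j = (A, B)" by fastforce
  have "two_rows w l = two_rows v l \<or> (\<exists>z. entry_lifted z (two_rows w l) (two_rows v l))"
    if "Suc i \<le> l" for l
    using that
  proof (induction l rule: dec_induct)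
    case base
    show ?case
    proof (cases "\<exists>c\<in>A. w (Suc (Suc j)) < c \<and> c < w (Suc j)")
      case True
      then show ?thesis using two_rows_descent_gap[OF _ AB] assms unfolding j v_def by metis
    next
      case False
      then show ?thesis
        using two_rows_descent_states(4)[OF _ AB] assms unfolding j v_def by (metis not_less)
    qed
  next
    case (step l)
    have vl: "v (Suc l) = w (Suc l)" using step by (simp add: v)
    show ?case
      using step.IH
    proof (elim disjE exE)
      fix z assume z: "entry_lifted z (two_rows w l) (two_rows v l)"
      then have "z \<in> fst (two_rows v l)" by (simp add: entry_lifted_def)
      then obtain p where p: "p \<in> {1..l}" "z = v p" using two_rows_subset[of v l] by auto
      \<comment> \<open>The entry \<open>z\<close> was read among the first \<open>l\<close>
        letters, and the swap does not touch position \<open>Suc l\<close>.\<close>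
      have "w (Suc l) \<noteq> z"
      proof
        assume "w (Suc l) = z"
        then have "Suc l = simple_refl i p" using p by (simp add: v w_inj)
        then have "p = simple_refl i (Suc l)" by (metis simple_refl_involutory_app)
        then show False using p step by simp
      qed
      then show ?thesis using entry_lifted_step[OF z] vl by simp
    qed (use vl in simp)
  qed
  then show ?thesis
    using n row2_insertion_tableau[OF fc]
      row2_insertion_tableau[OF fully_commutative_comp_descent[OF fc assms], folded v_def]
    unfolding v_def[symmetric]
    by (fastforce simp: entry_lifted_def)
qed

text \<open>Once the two states agree they agree forever, so they must differ up to
  \<open>n\<close>. This excludes a first-row entry between the letters, in particular
  \<open>w (i - 1)\<close>. It also excludes \<open>w (i + 2) < w i\<close>, since that letter would
  bump \<open>w i\<close> for \<open>?v\<close> and be appended for \<open>w\<close>.\<close>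

lemma descent_neighbours:
  assumes i: "i \<in> descents n w"
    and neq: "row2 (insertion_tableau n (w \<circ> simple_refl i)) \<noteq> row2 (insertion_tableau n w)"
  shows "1 < i \<Longrightarrow> w (i - 1) < w (Suc i)" and "i + 2 \<le> n \<Longrightarrow> w i < w (i + 2)"
proof -
  let ?v = "w \<circ> simple_refl i"
  obtain j where j: "i = Suc j" using i by (cases i) (auto simp: descents_iff)
  have n: "Suc i \<le> n" "w (Suc i) < w i" using i by (auto simp: descents_iff)
  obtain A B where AB: "two_rows w j = (A, B)" by fastforce
  have ne: "two_rows ?v l \<noteq> two_rows w l" if "Suc i \<le> l" "l \<le> n" for l
    using two_rows_eq_extend[of ?v l w n] that neq row2_insertion_tableau[OF fc]
      row2_insertion_tableau[OF fully_commutative_comp_descent[OF fc i]] by auto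
  have gap: "w (Suc j) \<le> c" if "c \<in> A" "w (Suc (Suc j)) < c" for c
    using two_rows_descent_gap[OF _ AB that] ne[of "Suc i"] n i j by (metis not_less order_refl)
  have st: "two_rows w (Suc i) = (insert (w (Suc i)) A, insert (w i) B)"
    "two_rows ?v (Suc i) = (insert (w (Suc i)) (insert (w i) A), B)"
    "\<forall>c\<in>A. c < w (Suc i)" "entry_lifted (w i) (two_rows w (Suc i)) (two_rows ?v (Suc i))"
    unfolding j by (rule two_rows_descent_states[OF i[unfolded j] AB]; use gap in blast)+
  show "w (i - 1) < w (Suc i)" if "1 < i"
    using last_letter_in_two_rows[of j w] st(3) that by (simp add: AB j)
  show "w i < w (i + 2)" if "i + 2 \<le> n"
  proof (rule ccontr)
    assume "\<not> w i < w (i + 2)"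
    moreover have "w i \<noteq> w (i + 2)" by (simp add: w_inj)
    ultimately have less: "w (i + 2) < w i" by simp
    have "w (i + 1) < w (i + 2)"
    proof (rule ccontr)
      assume "\<not> ?thesis"
      moreover have "w (i + 1) \<noteq> w (i + 2)" by (simp add: w_inj)
      ultimately have "w (i + 2) < w (i + 1)" by linarith
      then show False using no_321[of i "i + 1" "i + 2"] n that i by (auto simp: descents_iff)
    qed
    then have "\<forall>a\<in>fst (two_rows w (Suc i)). a \<le> w (i + 2)"
      unfolding st(1) using st(3) by force
    then have "bump_step (w (i + 2)) (two_rows w (Suc i)) = bump_step (w (i + 2)) (two_rows ?v (Suc i))"
      using entry_lifted_drop[OF st(4)[unfolded st(1,2)] less] unfolding st(1,2) by simp
    then have "two_rows ?v (i + 2) = two_rows w (i + 2)" by (simp add: comp_def del: two_rows.simps(1))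
    then show False using ne[of "i + 2"] that by simp
  qed
qed

end

section \<open>Crowded sets and minimality\<close>

lemma crowded_mono: "crowded A \<Longrightarrow> A \<subseteq> B \<Longrightarrow> crowded B"
  unfolding crowded_def
proof (elim exE conjE)
  fix x y :: int
  assume *: "A \<subseteq> B" "0 < x" "x + 1 < int (card ({y..y + 2 * x} \<inter> A))"
  have "card ({y..y + 2 * x} \<inter> A) \<le> card ({y..y + 2 * x} \<inter> B)"
    using *(1) by (intro card_mono) auto
  then show "\<exists>x y. 0 < x \<and> x + 1 < int (card ({y..y + 2 * x} \<inter> B))"
    using * by (intro exI[of _ x] exI[of _ y]) linarith
qed

text \<open>With \<open>c\<close> elements in the interval, the inequality says
  \<open>q - p <= 2 * (c - 2)\<close>, which is the definition of crowded for
  \<open>x = c - 2\<close>, with the ends of the interval in \<open>S\<close>.\<close>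

definition crowds :: "nat set \<Rightarrow> nat \<Rightarrow> nat \<Rightarrow> bool" where
  "crowds S p q \<longleftrightarrow> p \<in> S \<and> q \<in> S \<and> p \<le> q \<and> q + 4 \<le> p + 2 * card (S \<inter> {p..q})"

lemma crowded_iff_crowds: "crowded (int ` S) \<longleftrightarrow> (\<exists>p q. crowds S p q)"
proof
  assume "crowded (int ` S)"
  then obtain x y :: int where xy: "x > 0" "int (card ({y..y + 2 * x} \<inter> int ` S)) > x + 1"
    by (auto simp: crowded_def)
  define T where "T = {s \<in> S. int s \<in> {y..y + 2 * x}}"
  have T: "{y..y + 2 * x} \<inter> int ` S = int ` T" by (auto simp: T_def)
  have fin: "finite T"
    using finite_imageD[of int T] T by (metis finite_Int finite_atLeastAtMost_int inj_on_of_nat)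
  have card: "int (card T) > x + 1" using xy(2) unfolding T by (simp add: card_image)
  then have "T \<noteq> {}" using xy(1) by auto
  \<comment> \<open>Shrinking the interval to its extreme elements loses none of them.\<close>
  then have mem: "Min T \<in> T" "Max T \<in> T" "Min T \<le> Max T" using fin by auto
  have "S \<inter> {Min T..Max T} = T"
    using mem fin by (fastforce simp: T_def)
  moreover have "int (Max T) \<le> int (Min T) + 2 * x" using mem by (auto simp: T_def)
  ultimately have "crowds S (Min T) (Max T)"
    using mem card by (auto simp: crowds_def T_def)
  then show "\<exists>p q. crowds S p q" by blast
next
  assume "\<exists>p q. crowds S p q"
  then obtain p q where pq: "p \<in> S" "q \<in> S" "p \<le> q" "q + 4 \<le> p + 2 * card (S \<inter> {p..q})"
    by (auto simp: crowds_def)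
  let ?c = "card (S \<inter> {p..q})"
  \<comment> \<open>From \<open>p <= q\<close> one gets \<open>?c >= 2\<close>, and
    \<open>?c = 2\<close> would leave the single point \<open>p\<close>. So \<open>?c - 2\<close> is
    a legitimate positive \<open>x\<close>.\<close>
  have "?c \<noteq> 2"
  proof
    assume c: "?c = 2"
    then have "p = q" using pq by simp
    then have "S \<inter> {p..q} \<subseteq> {p}" by auto
    then have "?c \<le> 1" using card_mono[of "{p}"] by simp
    then show False using c by simp
  qed
  then have c: "?c \<ge> 3" using pq by linarith
  have "int ` (S \<inter> {p..q}) \<subseteq> {int p..int p + 2 * (int ?c - 2)} \<inter> int ` S" using pq by auto
  then have "card (int ` (S \<inter> {p..q})) \<le> card ({int p..int p + 2 * (int ?c - 2)} \<inter> int ` S)"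
    by (intro card_mono) auto
  moreover have "card (int ` (S \<inter> {p..q})) = ?c" by (simp add: card_image)
  ultimately show "crowded (int ` S)"
    unfolding crowded_def using c by (intro exI[of _ "int ?c - 2"] exI[of _ "int p"]) linarith
qed

text \<open>Since crowdedness passes upwards, a crowded element anywhere below \<open>w\<close>
  yields one a single step below; minimality then concerns single descents only.\<close>

lemma ex_crowded_below_of_right_weak_less:
  assumes "right_weak_less n u w" "fully_commutative n w" "crowded (int ` row2 (insertion_tableau n u))"
  shows "\<exists>i\<in>descents n w. crowded (int ` row2 (insertion_tableau n (w \<circ> simple_refl i)))"
  using assms unfolding right_weak_less_def
proof (induction rule: tranclp_induct)
  case (base v)
  then show ?case by (auto simp: right_weak_step_iff)
next
  case (step v w)
  obtain i where i: "i \<in> descents n w" "v = w \<circ> simple_refl i"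
    using step.hyps(2) by (auto simp: right_weak_step_iff)
  have fc: "fully_commutative n v"
    using fully_commutative_comp_descent[OF step.prems(1) i(1)] i(2) by simp
  then obtain j where j: "j \<in> descents n v" "crowded (int ` row2 (insertion_tableau n (v \<circ> simple_refl j)))"
    using step by blast
  interpret fc_perm n v using fc by unfold_locales
  have "crowded (int ` row2 (insertion_tableau n v))"
    by (rule crowded_mono[OF j(2) image_mono[OF row2_comp_descent_subset[OF j(1)]]])
  then show ?case using i by blast
qed

lemma minimal_crowded_iff:
  assumes "fully_commutative n w"
  shows "minimal_crowded n w \<longleftrightarrow>
    crowded (int ` row2 (insertion_tableau n w)) \<and>
    (\<forall>i\<in>descents n w. \<not> crowded (int ` row2 (insertion_tableau n (w \<circ> simple_refl i))))"
    (is "_ \<longleftrightarrow> ?c \<and> ?m")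
proof -
  have perm: "w permutes {1..n}" using assms by (simp add: fully_commutative_def)
  have "minimal_crowded n w" if "?c" "?m"
    using that ex_crowded_below_of_right_weak_less[OF _ assms] assms
    unfolding minimal_crowded_def crowded_perms_def by blast
  moreover have "?c \<and> ?m" if min: "minimal_crowded n w"
  proof
    show "?c" using min by (simp add: minimal_crowded_def crowded_perms_def)
    show "?m"
    proof (intro ballI notI)
      fix i
      assume i: "i \<in> descents n w"
      let ?u = "w \<circ> simple_refl i"
      assume "crowded (int ` row2 (insertion_tableau n ?u))"
      then have "?u \<in> crowded_perms n"
        using fully_commutative_comp_descent[OF assms i] by (simp add: crowded_perms_def)
      moreover have "?u \<noteq> w"
      proof
        assume "?u = w"
        then have "?u i = w i" by (rule fun_cong)
        then show False using permutes_inj_eq[OF perm, of "Suc i" i] by simp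
      qed
      moreover have "right_weak_step n ?u w" unfolding right_weak_step_iff using perm i by blast
      then have "right_weak_less n ?u w" unfolding right_weak_less_def by blast
      ultimately show False using min unfolding minimal_crowded_def by blast
    qed
  qed
  ultimately show ?thesis by blast
qed

section \<open>Permutations all of whose descents matter\<close>

text \<open>These are the inequalities that hold when the removal of every descent changes the
  second row; they make the insertion explicit.\<close>

locale structured = fc_perm +
  assumes below: "i \<in> descents n w \<Longrightarrow> 1 < i \<Longrightarrow> w (i - 1) < w (Suc i)"
    and above: "i \<in> descents n w \<Longrightarrow> i + 2 \<le> n \<Longrightarrow> w i < w (i + 2)"
begin

abbreviation D :: "nat set" where
  "D \<equiv> descents n w"

lemma Suc_notin_D: "i \<in> D \<Longrightarrow> Suc i \<notin> D"
  using no_321[of i "Suc i" "Suc (Suc i)"] by (auto simp: descents_iff)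

text \<open>Non-descents are right-to-left minima: if \<open>q - 1\<close> is a descent,
  \<open>below\<close> passes over the pair and compares \<open>w q\<close> with
  \<open>w (q - 2)\<close>.\<close>

lemma non_descent_less: "p \<notin> D \<Longrightarrow> 1 \<le> p \<Longrightarrow> p < q \<Longrightarrow> q \<le> n \<Longrightarrow> w p < w q"
proof (induction q rule: less_induct)
  case (less q)
  have neq: "w (q - 1) \<noteq> w q" using less.prems by (simp add: w_inj)
  consider "q - 1 = p" | "p < q - 1" "q - 1 \<notin> D" | "p < q - 1" "q - 1 \<in> D" using less.prems by linarith
  then show ?case
  proof cases
    case 1
    then show ?thesis using less.prems neq by (auto simp: descents_iff)
  next
    case 2
    then have "w (q - 1) < w q" using less.prems neq by (auto simp: descents_iff)
    moreover have "w p < w (q - 1)" using less.IH[of "q - 1"] 2 less.prems by simp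
    ultimately show ?thesis by (rule less_trans[rotated])
  next
    case 3
    then have b: "w (q - 2) < w q" using below[of "q - 1"] less.prems by (simp add: numeral_2_eq_2)
    have "p = q - 2 \<or> p < q - 2" using 3 by linarith
    moreover have "q - 2 < q" "q - 2 \<le> n" using less.prems by linarith+
    ultimately have "w p \<le> w (q - 2)" using less.IH[of "q - 2"] less.prems by auto
    then show ?thesis using b by simp
  qed
qed

lemma less_descent: "q \<in> D \<Longrightarrow> 1 \<le> p \<Longrightarrow> p < q \<Longrightarrow> w p < w q"
  using no_321[of p q "Suc q"] by (auto simp: descents_iff)

text \<open>All other first-row entries stand at non-descents, hence lie below the descent bottom,
  which therefore bumps its own top.\<close>

lemma least_above_top:
  assumes "l \<in> D"
  shows "least_above (w (Suc l)) (w ` ({1..l} - (D \<inter> {1..<l}))) (w l)"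
  unfolding least_above_def
proof (intro conjI ballI impI)
  have l: "1 \<le> l" "l < n" "w (Suc l) < w l" using assms by (auto simp: descents_iff)
  then show "w l \<in> w ` ({1..l} - (D \<inter> {1..<l}))" "w (Suc l) < w l" by auto
  fix a assume "a \<in> w ` ({1..l} - (D \<inter> {1..<l}))" "w (Suc l) < a"
  then obtain p where p: "a = w p" "1 \<le> p" "p \<le> l" "p \<in> D \<longrightarrow> p = l" by fastforce
  then show "w l \<le> a"
    using non_descent_less[of p "Suc l"] l \<open>w (Suc l) < a\<close> by fastforce
qed

text \<open>The range \<open>{1..<l}\<close> excludes \<open>l\<close> because a top is bumped only
  by the next letter.\<close>

lemma two_rows_eq:
  "l \<le> n \<Longrightarrow> two_rows w l = (w ` ({1..l} - (D \<inter> {1..<l})), w ` (D \<inter> {1..<l}))"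
proof (induction l)
  case (Suc l)
  let ?A = "w ` ({1..l} - (D \<inter> {1..<l}))" and ?B = "w ` (D \<inter> {1..<l})"
  have IH: "two_rows w l = (?A, ?B)" using Suc by simp
  show ?case
  proof (cases "l \<in> D")
    case True
    have "1 \<le> l" using True by (auto simp: descents_iff)
    have "{1..Suc l} - (D \<inter> {1..<Suc l}) = insert (Suc l) (({1..l} - (D \<inter> {1..<l})) - {l})"
      "D \<inter> {1..<Suc l} = insert l (D \<inter> {1..<l})"
      using True \<open>1 \<le> l\<close> by auto
    moreover have "w ` (X - {l}) = w ` X - {w l}" for X
      by (auto simp: w_inj)
    ultimately show ?thesis
      using bump_step_bump[OF least_above_top[OF True], of ?B] IH by simp
  next
    case False
    have "{1..Suc l} - (D \<inter> {1..<Suc l}) = insert (Suc l) ({1..l} - (D \<inter> {1..<l}))"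
      "D \<inter> {1..<Suc l} = D \<inter> {1..<l}"
      using False by (auto simp: less_Suc_eq)
    moreover have "a \<le> w (Suc l)" if a: "a \<in> ?A" for a
    proof -
      obtain p where "a = w p" "1 \<le> p" "p \<le> l" "p \<in> D \<longrightarrow> p = l" using a by fastforce
      then show ?thesis using non_descent_less[of p "Suc l"] False Suc.prems by fastforce
    qed
    then have "bump_step (w (Suc l)) (?A, ?B) = (insert (w (Suc l)) ?A, ?B)"
      by (intro bump_step_append) blast
    ultimately show ?thesis using IH by simp
  qed
qed simp

lemma row2_eq: "row2 (insertion_tableau n w) = w ` D"
proof -
  have "D \<inter> {1..<n} = D" by (auto simp: descents_iff)
  then show ?thesis using row2_insertion_tableau[OF fc] two_rows_eq[of n] by simp
qed

text \<open>
  Removing the descent at \<open>i\<close> keeps \<open>w i\<close> in the first row. Whenever the entry kept there is still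
  larger than a later letter, that letter bumps it instead of the next descent top, which takes over
  its role; so the entry finally missing from the second row is the top of the last descent of the
  chain.
\<close>

lemma row2_comp_descent:
  assumes i: "i \<in> D"
  shows "\<exists>m. (\<forall>m'\<le>m. i + 2 * m' \<in> D) \<and> (\<forall>m'<m. w (i + 2 * m' + 3) < w (i + 2 * m')) \<and>
    (\<forall>p. i + 2 * m + 1 < p \<longrightarrow> p \<le> n \<longrightarrow> w (i + 2 * m) < w p) \<and>
    row2 (insertion_tableau n (w \<circ> simple_refl i)) = w ` D - {w (i + 2 * m)}"
proof -
  define v where "v = w \<circ> simple_refl i"
  have v: "v l = w (simple_refl i l)" for l by (simp add: v_def)
  have n: "1 \<le> i" "Suc i \<le> n" "w (Suc i) < w i" using i by (auto simp: descents_iff)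
  obtain j where j: "i = Suc j" using n by (cases i) auto
  obtain A B where AB: "two_rows w j = (A, B)" by fastforce
  have A: "A = w ` ({1..j} - (D \<inter> {1..<j}))" using two_rows_eq[of j] n AB j by simp
  have "c < w (Suc (Suc j))" if c: "c \<in> A" for c
  proof -
    obtain p where "c = w p" "1 \<le> p" "p \<le> j" "p \<in> D \<longrightarrow> p = j" using c A by fastforce
    moreover have "j \<notin> D" using Suc_notin_D i j by auto
    ultimately show ?thesis using non_descent_less[of p "Suc (Suc j)"] n j by auto
  qed
  then have lifted: "entry_lifted (w i) (two_rows w (Suc i)) (two_rows v (Suc i))"
    using two_rows_descent_states(4)[OF i[unfolded j] AB] unfolding j v_def
    by (metis less_not_sym)
  \<comment> \<open>Here \<open>i + 2 * m\<close> is the position of the entry currently lifted, so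
    \<open>m\<close> counts how far the chain has advanced after \<open>l\<close> letters.\<close>
  have "\<exists>m. (\<forall>m'\<le>m. i + 2 * m' \<in> D) \<and> (\<forall>m'<m. w (i + 2 * m' + 3) < w (i + 2 * m')) \<and>
    i + 2 * m < l \<and> (\<forall>p. i + 2 * m + 1 < p \<longrightarrow> p \<le> l \<longrightarrow> w (i + 2 * m) < w p) \<and>
    entry_lifted (w (i + 2 * m)) (two_rows w l) (two_rows v l)" if "Suc i \<le> l" "l \<le> n" for l
    using that
  proof (induction l rule: dec_induct)
    case base
    show ?case using i lifted by (intro exI[of _ 0]) auto
  next
    case (step l)
    then obtain m where m: "\<forall>m'\<le>m. i + 2 * m' \<in> D" "\<forall>m'<m. w (i + 2 * m' + 3) < w (i + 2 * m')"
      "i + 2 * m < l" "\<forall>p. i + 2 * m + 1 < p \<longrightarrow> p \<le> l \<longrightarrow> w (i + 2 * m) < w p"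
      "entry_lifted (w (i + 2 * m)) (two_rows w l) (two_rows v l)"
      by auto
    define e where "e = i + 2 * m"
    have vl: "v (Suc l) = w (Suc l)" using step by (simp add: v)
    have eD: "e \<in> D" using m(1) by (simp add: e_def)
    have wl: "two_rows w l = (w ` ({1..l} - (D \<inter> {1..<l})), w ` (D \<inter> {1..<l}))"
      using two_rows_eq[of l] step.prems by simp
    obtain C E where CE: "two_rows v l = (C, E)" by fastforce
    show ?case
    proof (cases "w e < w (Suc l)")
      case True
      have "entry_lifted (w e) (two_rows w (Suc l)) (two_rows v (Suc l))"
        using entry_lifted_below[OF m(5)[unfolded wl CE, folded e_def] True]
        by (simp add: wl CE vl)
      then show ?thesis using m True by (intro exI[of _ m]) (auto simp: e_def le_Suc_eq)
    next
      case False
      then have less: "w (Suc l) < w e" using w_inj[of e "Suc l"] m(3) by (simp add: e_def)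
      \<comment> \<open>A letter below \<open>w e\<close> must be the bottom of the next descent:
        \<open>above\<close> rules out position \<open>e + 2\<close>, and \<open>below\<close> rules
        out every position beyond \<open>e + 3\<close>.\<close>
      have "Suc l \<noteq> e + 2" using above[OF eD] less step.prems by auto
      then have el: "e + 2 \<le> l" using m(3) by (simp add: e_def)
      then have wel: "w e < w l" using m(4) by (simp add: e_def)
      then have lD: "l \<in> D" using less step by (auto simp: descents_iff)
      have "\<not> e + 2 < l"
      proof
        assume "e + 2 < l"
        then have "w e < w (l - 1)" using m(4) by (simp add: e_def)
        moreover have "w (l - 1) < w (Suc l)" using below[OF lD] el by simp
        ultimately show False using less by simp
      qed
      then have l: "l = i + 2 * Suc m" using el by (simp add: e_def)
      have "entry_lifted (w l) (two_rows w (Suc l)) (two_rows v (Suc l))"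
        using entry_lifted_bump[OF m(5)[unfolded wl CE, folded e_def] less least_above_top[OF lD] wel]
        by (simp add: wl CE vl)
      moreover have "\<forall>m'\<le>Suc m. i + 2 * m' \<in> D" using m(1) lD l by (auto simp: le_Suc_eq)
      moreover have "w (i + 2 * m + 3) < w (i + 2 * m)" using less l by (simp add: e_def numeral_3_eq_3)
      then have "\<forall>m'<Suc m. w (i + 2 * m' + 3) < w (i + 2 * m')" using m(2) by (auto simp: less_Suc_eq)
      ultimately show ?thesis using l by (intro exI[of _ "Suc m"]) auto
    qed
  qed
  from this[OF n(2) order_refl] obtain m where m: "\<forall>m'\<le>m. i + 2 * m' \<in> D"
    "\<forall>m'<m. w (i + 2 * m' + 3) < w (i + 2 * m')"
    "\<forall>p. i + 2 * m + 1 < p \<longrightarrow> p \<le> n \<longrightarrow> w (i + 2 * m) < w p"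
    "entry_lifted (w (i + 2 * m)) (two_rows w n) (two_rows v n)" by blast
  have "fully_commutative n v" using fully_commutative_comp_descent[OF fc i] by (simp only: v_def)
  then have v_fc: "v permutes {1..n}" and row2_v: "row2 (insertion_tableau n v) = snd (two_rows v n)"
    using row2_insertion_tableau by (auto simp: fully_commutative_def)
  \<comment> \<open>The invariant alone allows the lifted entry in both rows of \<open>v\<close>;
    disjointness of the rows excludes this.\<close>
  have "w (i + 2 * m) \<notin> snd (two_rows v n)"
    using two_rows_disjoint[OF permutes_inj[OF v_fc], of n] m(4) by (auto simp: entry_lifted_def)
  moreover have "w ` D = insert (w (i + 2 * m)) (snd (two_rows v n))"
    using m(4) row2_eq row2_insertion_tableau[OF fc] by (simp add: entry_lifted_def)
  ultimately have "row2 (insertion_tableau n v) = w ` D - {w (i + 2 * m)}" using row2_v by auto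
  then show ?thesis using m by (auto simp: v_def)
qed

section \<open>Cuts and the density of descent tops beyond them\<close>

lemma le_cut: "e \<in> D \<Longrightarrow> 1 \<le> p \<Longrightarrow> p \<le> Suc e \<Longrightarrow> w p \<le> w e"
  using less_descent[of e p] by (cases "p < e") (auto simp: descents_iff le_Suc_eq)

text \<open>The first \<open>Suc e\<close> letters are at most \<open>w e\<close> and all later ones
  exceed it, so they fill \<open>{1..w e}\<close> and counting gives the value.\<close>

lemma cut_value:
  assumes e: "e \<in> D" and cut: "\<And>p. Suc e < p \<Longrightarrow> p \<le> n \<Longrightarrow> w e < w p"
  shows "w e = Suc e"
proof -
  have en: "1 \<le> e" "Suc e \<le> n" using e by (auto simp: descents_iff)
  have "w ` {1..Suc e} = {1..w e}"
  proof (intro equalityI subsetI)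
    fix a assume "a \<in> w ` {1..Suc e}"
    then obtain p where "a = w p" "1 \<le> p" "p \<le> Suc e" by auto
    then show "a \<in> {1..w e}" using le_cut[OF e, of p] w_range[of p] en by auto
  next
    fix a assume a: "a \<in> {1..w e}"
    obtain p where p: "w p = a" using permutes_surj[OF perm] by (metis surjD)
    have "a \<in> {1..n}" using a w_range[of e] en by auto
    then have "p \<in> {1..n}" using w_range[of p] p by simp
    then have "p \<le> Suc e" using cut[of p] a p by (meson atLeastAtMost_iff not_less)
    then show "a \<in> w ` {1..Suc e}" using p \<open>p \<in> {1..n}\<close> by auto
  qed
  moreover have "card (w ` {1..Suc e}) = Suc e"
    using permutes_inj[OF perm] by (simp add: card_image inj_on_def w_inj)
  ultimately show ?thesis by simp
qed

text \<open>Each top counted comes with its bottom, which also lies in \<open>{w e<..q}\<close>;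
  these pairs are disjoint since adjacent descents do not occur.\<close>

lemma descent_tops_above_cut:
  assumes e: "e \<in> D" and cut: "\<And>p. Suc e < p \<Longrightarrow> p \<le> n \<Longrightarrow> w e < w p"
  shows "2 * card (w ` D \<inter> {w e<..q}) \<le> q - w e"
proof -
  define J where "J = {j \<in> D. w e < w j \<and> w j \<le> q}"
  have img: "w ` D \<inter> {w e<..q} = w ` J" by (auto simp: J_def)
  have "finite J" unfolding J_def by (rule finite_subset[of _ "{1..<n}"]) (auto simp: descents_iff)
  have inj: "inj_on w X" for X by (auto simp: inj_on_def w_inj)
  have "w ` (J \<union> Suc ` J) \<subseteq> {w e<..q}"
  proof
    fix a assume "a \<in> w ` (J \<union> Suc ` J)"
    then obtain j where j: "j \<in> J" "a = w j \<or> a = w (Suc j)" by auto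
    then have jD: "j \<in> D" "w e < w j" "w j \<le> q" by (auto simp: J_def)
    then have bounds: "1 \<le> j" "Suc j \<le> n" "w (Suc j) < w j" by (auto simp: descents_iff)
    then have "Suc e < j" using le_cut[OF e, of j] jD by (meson not_less)
    then show "a \<in> {w e<..q}" using j(2) cut[of "Suc j"] jD bounds by auto
  qed
  then have "card (w ` (J \<union> Suc ` J)) \<le> q - w e" using card_mono[of "{w e<..q}"] by fastforce
  moreover have "J \<inter> Suc ` J = {}" using Suc_notin_D by (auto simp: J_def)
  then have "card (J \<union> Suc ` J) = 2 * card J"
    using \<open>finite J\<close> by (simp add: card_Un_disjoint card_image)
  ultimately show ?thesis unfolding img by (simp add: card_image[OF inj])
qed

end

lemma crowds_Diff: "crowds S p q \<Longrightarrow> a \<notin> {p..q} \<Longrightarrow> crowds (S - {a}) p q"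
proof -
  assume *: "crowds S p q" "a \<notin> {p..q}"
  then have "(S - {a}) \<inter> {p..q} = S \<inter> {p..q}" by auto
  then show ?thesis using * by (auto simp: crowds_def)
qed

context structured
begin

text \<open>The top ending a chain lies in every crowding interval, as its deletion must destroy
  them all. If it were below \<open>q\<close>, the density bound would make \<open>{p..c}\<close>
  crowding, but the chain starting at the descent with top \<open>q\<close> ends at or above
  \<open>q\<close>, outside that interval.\<close>

lemma minimal_chain_end:
  assumes crowds: "crowds (w ` D) p q"
    and min: "\<And>i. i \<in> D \<Longrightarrow> \<not> crowded (int ` row2 (insertion_tableau n (w \<circ> simple_refl i)))"
    and i: "i \<in> D"
  shows "\<exists>m. (\<forall>m'\<le>m. i + 2 * m' \<in> D) \<and> (\<forall>m'<m. w (i + 2 * m' + 3) < w (i + 2 * m')) \<and>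
    w (i + 2 * m) = q"
proof -
  let ?S = "w ` D"
  have ends: "\<exists>m. (\<forall>m'\<le>m. i + 2 * m' \<in> D) \<and> (\<forall>m'<m. w (i + 2 * m' + 3) < w (i + 2 * m')) \<and>
    (\<forall>p. i + 2 * m + 1 < p \<longrightarrow> p \<le> n \<longrightarrow> w (i + 2 * m) < w p) \<and>
    (\<forall>a b. crowds ?S a b \<longrightarrow> w (i + 2 * m) \<in> {a..b})" if "i \<in> D" for i
    using row2_comp_descent[OF that] min[OF that] crowds_Diff crowded_iff_crowds by metis
  obtain m where m: "\<forall>m'\<le>m. i + 2 * m' \<in> D" "\<forall>m'<m. w (i + 2 * m' + 3) < w (i + 2 * m')"
    "\<forall>p. i + 2 * m + 1 < p \<longrightarrow> p \<le> n \<longrightarrow> w (i + 2 * m) < w p"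
    "\<forall>a b. crowds ?S a b \<longrightarrow> w (i + 2 * m) \<in> {a..b}" using ends[OF i] by blast
  define c where "c = w (i + 2 * m)"
  have pcq: "p \<le> c" "c \<le> q" using m(4) crowds by (auto simp: c_def)
  have cS: "c \<in> ?S" using m(1) by (auto simp: c_def)
  have "\<not> c < q"
  proof
    assume "c < q"
    have fin: "finite ?S" by (rule finite_imageI) (auto simp: descents_def)
    have "?S \<inter> {p..q} = (?S \<inter> {p..c}) \<union> (?S \<inter> {c<..q})" using pcq by auto
    then have "card (?S \<inter> {p..q}) = card (?S \<inter> {p..c}) + card (?S \<inter> {c<..q})"
      using fin by (simp add: card_Un_disjoint disjoint_iff)
    moreover have "2 * card (?S \<inter> {c<..q}) \<le> q - c"
      unfolding c_def by (rule descent_tops_above_cut) (use m in auto)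
    ultimately have left: "crowds ?S p c"
      using crowds cS pcq \<open>c < q\<close> by (auto simp: crowds_def)
    obtain j where j: "j \<in> D" "q = w j" using crowds by (auto simp: crowds_def)
    obtain m' where m': "j + 2 * m' \<in> D" "w (j + 2 * m') \<in> {p..c}"
      using ends[OF j(1)] left by blast
    have "w j \<le> w (j + 2 * m')"
      using less_descent[OF m'(1), of j] j(1) by (cases "m' = 0") (auto simp: descents_iff)
    then show False using m'(2) j \<open>c < q\<close> by auto
  qed
  then show ?thesis using m pcq by (intro exI[of _ m]) (auto simp: c_def)
qed

text \<open>All chains end at the descent with top \<open>q\<close>, so the chain from the first
  descent passes through every other one.\<close>

lemma minimal_single_chain:
  assumes crowded: "crowded (int ` row2 (insertion_tableau n w))"
    and min: "\<And>i. i \<in> D \<Longrightarrow> \<not> crowded (int ` row2 (insertion_tableau n (w \<circ> simple_refl i)))"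
  shows "\<exists>d k. D = (\<lambda>i. d + 2 * i) ` {0..k} \<and> (\<forall>i<k. w (d + 2 * i + 3) < w (d + 2 * i))"
proof -
  obtain p q where pq: "crowds (w ` D) p q"
    using crowded unfolding row2_eq crowded_iff_crowds by blast
  obtain e where e: "e \<in> D" "w e = q" using pq by (auto simp: crowds_def)
  have chain: "\<exists>m. (\<forall>m'\<le>m. i + 2 * m' \<in> D) \<and> (\<forall>m'<m. w (i + 2 * m' + 3) < w (i + 2 * m')) \<and>
    i + 2 * m = e" if "i \<in> D" for i
    using minimal_chain_end[OF pq min that] e(2) w_inj by metis
  define d where "d = Min D"
  have fin: "finite D" by (simp add: descents_def)
  have d: "d \<in> D" unfolding d_def using fin e by (intro Min_in) auto
  obtain k where k: "\<forall>m\<le>k. d + 2 * m \<in> D" "\<forall>m<k. w (d + 2 * m + 3) < w (d + 2 * m)" "d + 2 * k = e"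
    using chain[OF d] by blast
  have "D = (\<lambda>i. d + 2 * i) ` {0..k}"
  proof (intro equalityI subsetI)
    fix i assume i: "i \<in> D"
    obtain m where m: "i + 2 * m = e" using chain[OF i] by blast
    have "d \<le> i" unfolding d_def using fin i by (rule Min_le)
    then have "i = d + 2 * (k - m)" "k - m \<in> {0..k}" using m k(3) by auto
    then show "i \<in> (\<lambda>i. d + 2 * i) ` {0..k}" by blast
  qed (use k in auto)
  then show ?thesis using k by blast
qed

end

section \<open>A single chain of descents\<close>

lemma occurrence_415263_iff:
  "occurrence n w [4, 1, 5, 2, 6, 3] [p, q, r, s, t, u] \<longleftrightarrow>
     1 \<le> p \<and> p < q \<and> q < r \<and> r < s \<and> s < t \<and> t < u \<and> u \<le> n \<and>
     w q < w s \<and> w s < w u \<and> w u < w p \<and> w p < w r \<and> w r < w t"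
  unfolding occurrence_def by (auto simp: All_less_Suc eval_nat_numeral)

lemma occurrence_315264_iff:
  "occurrence n w [3, 1, 5, 2, 6, 4] [p, q, r, s, t, u] \<longleftrightarrow>
     1 \<le> p \<and> p < q \<and> q < r \<and> r < s \<and> s < t \<and> t < u \<and> u \<le> n \<and>
     w q < w s \<and> w s < w p \<and> w p < w u \<and> w u < w r \<and> w r < w t"
  unfolding occurrence_def by (auto simp: All_less_Suc eval_nat_numeral)

lemma upt_six: "[p..<p + 6] = [p, p + 1, p + 2, p + 3, p + 4, p + 5]"
  by (simp add: upt_rec)

text \<open>By \<open>link\<close>, the bottom of each descent after the first lies below the top of
  the preceding one.\<close>

locale single_chain = structured +
  fixes d k :: nat
  assumes D_eq: "D = (\<lambda>i. d + 2 * i) ` {0..k}"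
    and link: "i < k \<Longrightarrow> w (d + 2 * i + 3) < w (d + 2 * i)"
begin

abbreviation y :: "nat \<Rightarrow> nat" where "y i \<equiv> w (d + 2 * i)"

abbreviation x :: "nat \<Rightarrow> nat" where "x i \<equiv> w (d + 2 * i + 1)"

lemma in_D: "i \<le> k \<Longrightarrow> d + 2 * i \<in> D"
  by (auto simp: D_eq)

lemma odd_notin_D: "i \<le> k \<Longrightarrow> d + 2 * i + 1 \<notin> D"
  using Suc_notin_D[OF in_D] by simp

lemma bounds: "1 \<le> d" "d + 2 * k + 1 \<le> n"
  using in_D[of 0] in_D[of k] by (auto simp: descents_iff)

lemma window_position:
  assumes "d \<le> p" "p \<le> d + 2 * k + 1"
  obtains l where "l \<le> k" "p = d + 2 * l" | l where "l \<le> k" "p = d + 2 * l + 1"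
proof -
  have "p = d + 2 * ((p - d) div 2) \<or> p = d + 2 * ((p - d) div 2) + 1"
    using assms by presburger
  moreover have "(p - d) div 2 \<le> k" using assms by linarith
  ultimately show thesis using that by blast
qed

lemma y_less: "i < j \<Longrightarrow> j \<le> k \<Longrightarrow> y i < y j"
  using less_descent[OF in_D[of j], of "d + 2 * i"] bounds by simp

lemma y_less_iff: "i \<le> k \<Longrightarrow> j \<le> k \<Longrightarrow> y i < y j \<longleftrightarrow> i < j"
  using y_less[of i j] y_less[of j i] by (cases i j rule: linorder_cases) auto

lemma x_less: "i < j \<Longrightarrow> j \<le> k \<Longrightarrow> x i < x j"
  using non_descent_less[OF odd_notin_D[of i], of "d + 2 * j + 1"] bounds by simp

lemma x_less_y: "i \<le> k \<Longrightarrow> x i < y i"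
  using in_D[of i] by (auto simp: descents_iff)

lemma x_Suc_less_y: "i < k \<Longrightarrow> x (i + 1) < y i"
  using link[of i] by (simp add: numeral_3_eq_3)

lemma notin_D: "p < d \<or> d + 2 * k + 1 < p \<Longrightarrow> p \<notin> D"
  by (auto simp: D_eq)

lemma fixed_before:
  assumes "1 \<le> p" "p < d"
  shows "w p = p"
proof (rule permutes_increasing_eq_id[OF perm, of 1 d])
  show "w i < w j" if "1 \<le> i" "i < d" "i < j" "j \<le> n" for i j
    using non_descent_less[OF notin_D] that by blast
  show "1 \<le> w i" if "1 \<le> i" "i \<le> n" for i using w_range[of i] that by simp
qed (use assms bounds in auto)

lemma above_chain: "d + 2 * k + 1 < p \<Longrightarrow> p \<le> n \<Longrightarrow> y k < w p"
proof -
  assume p: "d + 2 * k + 1 < p" "p \<le> n"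
  have "y k < w (d + 2 * k + 2)" using above[OF in_D[of k]] p by simp
  also have "\<dots> \<le> w p"
    using non_descent_less[OF notin_D, of "d + 2 * k + 2" p] p by (cases "p = d + 2 * k + 2") auto
  finally show ?thesis .
qed

text \<open>The last descent is a cut, so the chain ends at its largest value and everything beyond
  it is separated.\<close>

lemma y_last: "y k = d + 2 * k + 1"
  using cut_value[OF in_D[of k]] above_chain by simp

lemma y_le: "i \<le> k \<Longrightarrow> y i \<le> d + 2 * k + 1"
  using y_less[of i k] y_last by (cases "i = k") auto

lemma fixed_after:
  assumes "d + 2 * k + 1 < p" "p \<le> n"
  shows "w p = p"
proof (rule permutes_increasing_eq_id[OF perm, of "d + 2 * k + 2" "Suc n"])
  show "w i < w j" if "d + 2 * k + 2 \<le> i" "i < j" "j \<le> n" for i j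
    using non_descent_less[OF notin_D, of i j] that by simp
  show "w i < d + 2 * k + 2" if "1 \<le> i" "i < d + 2 * k + 2" for i
    using le_cut[OF in_D[of k], of i] that y_last by simp
  show "d + 2 * k + 2 \<le> w i" if "d + 2 * k + 2 \<le> i" "i \<le> n" for i
    using above_chain[of i] that y_last by simp
qed (use assms in auto)

lemma fixed_outside: "p \<in> {1..n} - {d..d + 2 * k + 1} \<Longrightarrow> w p = p"
  using fixed_before[of p] fixed_after[of p] by (cases "p < d") auto

lemma le_w:
  assumes "d \<le> p" "p \<le> n"
  shows "d \<le> w p"
proof (rule ccontr)
  assume "\<not> d \<le> w p"
  then have "w (w p) = w p" using fixed_before[of "w p"] w_range[of p] assms bounds by auto
  then show False using \<open>\<not> d \<le> w p\<close> assms by (simp add: w_inj)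
qed

text \<open>Its cardinality is the overlap count \<open>c_i\<close>. Only \<open>l >= i\<close>
  matters, since earlier bottoms always lie below \<open>y i\<close>.\<close>

definition bottoms :: "nat \<Rightarrow> nat set" where
  "bottoms i = {l \<in> {i..k}. x l < y i}"

text \<open>The values from \<open>d\<close> up to \<open>y i\<close> are taken at the
  \<open>2 * i\<close> earlier positions of the chain and at the bottoms counted; \<open>?P\<close>
  lists these positions.\<close>

lemma y_eq:
  assumes "i \<le> k"
  shows "y i = d + 2 * i + card (bottoms i)"
proof -
  let ?P = "(\<lambda>l. d + 2 * l) ` {0..<i} \<union> (\<lambda>l. d + 2 * l + 1) ` ({0..<i} \<union> bottoms i)"
  have "w ` ?P = {d..<y i}"
  proof (intro equalityI subsetI)
    fix a assume "a \<in> w ` ?P"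
    then consider l where "l < i" "a = y l" | l where "l < i" "a = x l" | l where "l \<in> bottoms i" "a = x l"
      by auto
    then show "a \<in> {d..<y i}"
    proof cases
      case 1
      then show ?thesis using y_less[of l i] le_w[of "d + 2 * l"] assms bounds by simp
    next
      case 2
      then have "x l < y i" using x_less_y[of l] y_less[of l i] assms by linarith
      then show ?thesis using 2 le_w[of "d + 2 * l + 1"] assms bounds by simp
    next
      case 3
      then show ?thesis using le_w[of "d + 2 * l + 1"] bounds by (simp add: bottoms_def)
    qed
  next
    fix a assume a: "a \<in> {d..<y i}"
    obtain p where p: "w p = a" using permutes_surj[OF perm] by (metis surjD)
    have "d + 2 * i \<in> {1..n}" using assms bounds by simp
    then have "a \<in> {1..n}" using a w_range[of "d + 2 * i"] bounds by auto
    then have "p \<in> {1..n}" using w_range[of p] p by simp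
    moreover have "\<not> p < d" using fixed_before[of p] p a calculation by auto
    moreover have "\<not> d + 2 * k + 1 < p" using fixed_after[of p] p a calculation y_le[OF assms] by auto
    ultimately have "d \<le> p" "p \<le> d + 2 * k + 1" by auto
    then show "a \<in> w ` ?P"
    proof (cases rule: window_position)
      case (1 l)
      then have "l < i" using y_less_iff[of l i] assms a p by auto
      then show ?thesis using 1 p by auto
    next
      case (2 l)
      then have "l \<in> {0..<i} \<union> bottoms i" using a p by (auto simp: bottoms_def)
      then show ?thesis using 2 p by blast
    qed
  qed
  then have "card (w ` ?P) = y i - d" by simp
  moreover have "card (w ` ?P) = card ?P" by (rule card_image) (simp add: inj_on_def w_inj)
  moreover have "(\<lambda>l. d + 2 * l) ` {0..<i} \<inter> (\<lambda>l. d + 2 * l + 1) ` ({0..<i} \<union> bottoms i) = {}"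
    by (auto simp: disjoint_iff) presburger+
  moreover have fin: "finite (bottoms i)" by (simp add: bottoms_def)
  moreover have "{0..<i} \<inter> bottoms i = {}" by (auto simp: bottoms_def)
  ultimately have "y i - d = i + (i + card (bottoms i))"
    by (simp add: card_Un_disjoint card_image inj_on_def del: image_Un)
  moreover have "d \<le> y i" using le_w[of "d + 2 * i"] assms bounds by simp
  ultimately show ?thesis by simp
qed

text \<open>Bottoms increase, so \<open>bottoms i\<close> is an initial segment of
  \<open>{i..k}\<close> and its size is tested at one index.\<close>

lemma card_bottoms_ge:
  assumes "i + r \<le> k" "x (i + r) < y i"
  shows "Suc r \<le> card (bottoms i)"
proof -
  have "{i..i + r} \<subseteq> bottoms i"
  proof
    fix l assume "l \<in> {i..i + r}"
    then have "x l \<le> x (i + r)" "l \<in> {i..k}" using x_less[of l "i + r"] assms by (auto simp: order_le_less)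
    then show "l \<in> bottoms i" using assms by (auto simp: bottoms_def)
  qed
  then show ?thesis using card_mono[of "bottoms i" "{i..i + r}"] by (simp add: bottoms_def)
qed

text \<open>The hypothesis is conditional because for \<open>i + r > k\<close> there are at most
  \<open>r\<close> indices anyway.\<close>

lemma card_bottoms_le:
  assumes "i + r \<le> k \<Longrightarrow> y i < x (i + r)"
  shows "card (bottoms i) \<le> r"
proof -
  have "bottoms i \<subseteq> {i..<i + r}"
  proof
    fix l assume l: "l \<in> bottoms i"
    show "l \<in> {i..<i + r}"
    proof (rule ccontr)
      assume "l \<notin> {i..<i + r}"
      then have r: "i + r \<le> l" "l \<le> k" using l by (auto simp: bottoms_def)
      then have "x (i + r) \<le> x l" using x_less[of "i + r" l] by (cases "i + r = l") auto
      then show False using assms r l by (auto simp: bottoms_def)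
    qed
  qed
  then show ?thesis using card_mono[of "{i..<i + r}"] by fastforce
qed

text \<open>The interval holds \<open>j - i + 1\<close> tops, and \<open>y_eq\<close> makes its
  length \<open>2 * (j - i)\<close> plus the difference of the overlap counts. The set
  \<open>I\<close> covers both the full chain and the chain without its last top.\<close>

lemma crowds_y_iff:
  assumes I: "I \<subseteq> {0..k}" "{i..j} \<subseteq> I" "i \<le> j"
  shows "crowds (y ` I) (y i) (y j) \<longleftrightarrow> card (bottoms j) + 2 \<le> card (bottoms i)"
proof -
  have mem: "i \<in> I" "j \<in> I" using I by auto
  then have ij: "i \<in> I" "j \<in> I" "i \<le> k" "j \<le> k" using I(1) by auto
  have "y ` I \<inter> {y i..y j} = y ` {i..j}"
  proof (intro equalityI subsetI)
    fix a assume "a \<in> y ` I \<inter> {y i..y j}"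
    then obtain l where l: "l \<in> I" "a = y l" "\<not> y l < y i" "\<not> y j < y l" by auto
    have "l \<le> k" using l I by auto
    then have "l \<in> {i..j}" using l y_less_iff ij by auto
    then show "a \<in> y ` {i..j}" using l by blast
  next
    fix a assume "a \<in> y ` {i..j}"
    then obtain l where l: "l \<in> {i..j}" "a = y l" by auto
    then have "\<not> y l < y i" "\<not> y j < y l" using y_less_iff[of l i] y_less_iff[of j l] ij by auto
    moreover have "l \<in> I" using l I by auto
    ultimately show "a \<in> y ` I \<inter> {y i..y j}" using l by auto
  qed
  moreover have "card (y ` {i..j}) = Suc j - i"
    by (subst card_image) (auto simp: inj_on_def w_inj)
  moreover have "y i \<le> y j" using y_less[of i j] I ij by (cases "i = j") auto
  ultimately have "crowds (y ` I) (y i) (y j) \<longleftrightarrow> y j + 4 \<le> y i + 2 * (Suc j - i)"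
    using ij by (simp add: crowds_def)
  also have "\<dots> \<longleftrightarrow> card (bottoms j) + 2 \<le> card (bottoms i)"
    using y_eq[OF ij(3)] y_eq[OF ij(4)] \<open>i \<le> j\<close> by linarith
  finally show ?thesis .
qed

lemma crowds_yD:
  assumes "crowded (int ` y ` I)" "I \<subseteq> {0..k}" "\<And>i j. i \<in> I \<Longrightarrow> j \<in> I \<Longrightarrow> {i..j} \<subseteq> I"
  obtains i j where "i \<in> I" "j \<in> I" "card (bottoms j) + 2 \<le> card (bottoms i)"
proof -
  obtain p q where pq: "crowds (y ` I) p q" using assms(1) crowded_iff_crowds by blast
  then obtain i j where ij: "i \<in> I" "j \<in> I" "p = y i" "q = y j" by (auto simp: crowds_def)
  have "\<not> y j < y i" using pq ij by (simp add: crowds_def)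
  moreover have "i \<le> k" "j \<le> k" using ij assms(2) by auto
  ultimately have "i \<le> j" using y_less_iff[of j i] by simp
  then have "card (bottoms j) + 2 \<le> card (bottoms i)"
    using crowds_y_iff[OF assms(2) assms(3)[OF ij(1,2)]] pq ij by simp
  then show thesis using that ij by blast
qed

lemma image_D: "w ` D = y ` {0..k}"
  by (simp add: D_eq image_image)

text \<open>By \<open>link\<close> no descent before the last is a cut, so every removal deletes the
  same top \<open>y k\<close>.\<close>

lemma row2_comp_descent_chain:
  assumes "i \<in> D"
  shows "row2 (insertion_tableau n (w \<circ> simple_refl i)) = y ` {0..<k}"
proof -
  obtain m where m: "i + 2 * m \<in> D"
    "\<And>p. i + 2 * m + 1 < p \<Longrightarrow> p \<le> n \<Longrightarrow> w (i + 2 * m) < w p"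
    "row2 (insertion_tableau n (w \<circ> simple_refl i)) = w ` D - {w (i + 2 * m)}"
    using row2_comp_descent[OF assms] by blast
  obtain b where b: "b \<le> k" "i + 2 * m = d + 2 * b" using m(1) by (auto simp: D_eq)
  have "b = k"
  proof (rule ccontr)
    assume "b \<noteq> k"
    then have "b < k" using b by simp
    then show False using m(2)[of "d + 2 * b + 3"] link[of b] bounds by (simp add: b(2))
  qed
  moreover have "y ` {0..k} - {y k} = y ` {0..<k}" by (auto simp: w_inj)
  ultimately show ?thesis using m(3) b(2) image_D by simp
qed

text \<open>Each overlap count is at least 1, so crowdedness forces one that is at least 3.\<close>

lemma crowded_imp_long_overlap:
  assumes "crowded (int ` row2 (insertion_tableau n w))"
  shows "\<exists>i. i + 2 \<le> k \<and> x (i + 2) < y i"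
proof -
  have "crowded (int ` y ` {0..k})" using assms unfolding row2_eq image_D .
  then obtain i j where ij: "i \<in> {0..k}" "j \<in> {0..k}" "card (bottoms j) + 2 \<le> card (bottoms i)"
    by (rule crowds_yD) auto
  have "1 \<le> card (bottoms j)" using card_bottoms_ge[of j 0] x_less_y[of j] ij by simp
  then have "\<not> card (bottoms i) \<le> 2" using ij by simp
  then have "i + 2 \<le> k" "\<not> y i < x (i + 2)" using card_bottoms_le[of i 2] by blast+
  moreover have "y i \<noteq> x (i + 2)" by (simp add: w_inj)
  ultimately show ?thesis by (meson linorder_neqE_nat)
qed

text \<open>Without the last top every count is at least 2, so counts at most 3 prevent crowding; a
  count of 4 or more crowds together with index \<open>k - 1\<close>, whose count is at most
  2.\<close>

lemma not_crowded_initial_iff: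
  "\<not> crowded (int ` y ` {0..<k}) \<longleftrightarrow> (\<forall>i. i + 3 \<le> k \<longrightarrow> y i < x (i + 3))"
proof
  assume nc: "\<not> crowded (int ` y ` {0..<k})"
  show "\<forall>i. i + 3 \<le> k \<longrightarrow> y i < x (i + 3)"
  proof (intro allI impI, rule ccontr)
    fix i assume i: "i + 3 \<le> k" "\<not> y i < x (i + 3)"
    moreover have "y i \<noteq> x (i + 3)" by (simp add: w_inj)
    ultimately have "x (i + 3) < y i" by linarith
    then have "4 \<le> card (bottoms i)" using card_bottoms_ge[of i 3] i by simp
    moreover have "card (bottoms (k - 1)) \<le> 2" by (rule card_bottoms_le) (use i in auto)
    ultimately have "crowds (y ` {0..<k}) (y i) (y (k - 1))"
      using crowds_y_iff[of "{0..<k}" i "k - 1"] i by fastforce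
    then show False using nc crowded_iff_crowds by blast
  qed
next
  assume short: "\<forall>i. i + 3 \<le> k \<longrightarrow> y i < x (i + 3)"
  show "\<not> crowded (int ` y ` {0..<k})"
  proof
    assume "crowded (int ` y ` {0..<k})"
    then obtain i j where ij: "i \<in> {0..<k}" "j \<in> {0..<k}" "card (bottoms j) + 2 \<le> card (bottoms i)"
      by (rule crowds_yD) auto
    have "2 \<le> card (bottoms j)" using card_bottoms_ge[of j 1] x_Suc_less_y[of j] ij by simp
    moreover have "card (bottoms i) \<le> 3" using card_bottoms_le[of i 3] short by blast
    ultimately show False using ij by simp
  qed
qed

text \<open>The chain fixes the relative order of the six letters except for
  \<open>x (i + 2)\<close> against \<open>y i\<close>, which decides between the two
  patterns.\<close>

lemma occurrence_window:
  assumes "i + 2 \<le> k"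
  shows "x (i + 2) < y i \<Longrightarrow> occurrence n w [4, 1, 5, 2, 6, 3] [d + 2 * i..<d + 2 * i + 6]"
    and "\<not> x (i + 2) < y i \<Longrightarrow> occurrence n w [3, 1, 5, 2, 6, 4] [d + 2 * i..<d + 2 * i + 6]"
proof -
  have e: "d + 2 * i + 2 = d + 2 * (i + 1)" "d + 2 * i + 3 = d + 2 * (i + 1) + 1"
    "d + 2 * i + 4 = d + 2 * (i + 2)" "d + 2 * i + 5 = d + 2 * (i + 2) + 1" by simp_all
  have ord: "x i < x (i + 1)" "x (i + 1) < x (i + 2)" "y i < y (i + 1)" "y (i + 1) < y (i + 2)"
    "x (i + 1) < y i" "x (i + 2) < y (i + 1)"
    using x_less[of i "i + 1"] x_less[of "i + 1" "i + 2"] y_less[of i "i + 1"]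
      y_less[of "i + 1" "i + 2"] x_Suc_less_y[of i] x_Suc_less_y[of "i + 1"] assms
    by (simp_all add: numeral_2_eq_2)
  have n: "1 \<le> d + 2 * i" "d + 2 * (i + 2) + 1 \<le> n" using assms bounds by auto
  show "x (i + 2) < y i \<Longrightarrow> occurrence n w [4, 1, 5, 2, 6, 3] [d + 2 * i..<d + 2 * i + 6]"
    unfolding upt_six occurrence_415263_iff e using ord n by simp
  assume "\<not> x (i + 2) < y i"
  moreover have "x (i + 2) \<noteq> y i" by (simp add: w_inj)
  ultimately have "y i < x (i + 2)" by linarith
  then show "occurrence n w [3, 1, 5, 2, 6, 4] [d + 2 * i..<d + 2 * i + 6]"
    unfolding upt_six occurrence_315264_iff e using ord n by simp
qed

text \<open>The first letter exceeds the last, so they are a top \<open>y i\<close> and a bottom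
  \<open>x l\<close>; as \<open>short\<close> gives \<open>l <= i + 2\<close>, only six positions
  are available.\<close>

lemma occurrence_consecutive:
  assumes short: "\<And>i. i + 3 \<le> k \<Longrightarrow> y i < x (i + 3)"
    and occ: "occurrence n w [4, 1, 5, 2, 6, 3] ps"
  shows "consecutive_positions ps"
proof -
  have "length ps = 6" using occ by (simp add: occurrence_def)
  then obtain p q r s t u where ps: "ps = [p, q, r, s, t, u]"
    by (auto simp: eval_nat_numeral length_Suc_conv)
  then have o: "1 \<le> p" "p < q" "q < r" "r < s" "s < t" "t < u" "u \<le> n" "w u < w p"
    using occ unfolding ps occurrence_415263_iff by auto
  have "p \<in> D" using non_descent_less[of p u] o by fastforce
  then obtain i where i: "i \<le> k" "p = d + 2 * i" by (auto simp: D_eq)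
  have "u \<notin> D" using less_descent[of u p] o by auto
  have "u \<le> d + 2 * k + 1" using fixed_after[of u] o y_le[of i] i by fastforce
  then obtain l where l: "l \<le> k" "u = d + 2 * l + 1"
    using window_position[of u] i o \<open>u \<notin> D\<close> in_D by (metis le_add1 le_trans less_imp_le less_trans)
  have "l < i + 3"
  proof (rule ccontr)
    assume "\<not> l < i + 3"
    then have "x (i + 3) \<le> x l" using x_less[of "i + 3" l] l by (cases "i + 3 = l") auto
    then show False using short[of i] \<open>\<not> l < i + 3\<close> l o(8) i by simp
  qed
  then have "ps = [p..<p + 6]" unfolding upt_six ps using o i l by simp
  then show ?thesis using \<open>length ps = 6\<close> unfolding consecutive_positions_def by auto
qed

end

lemma structured_of_minimal:
  assumes "fully_commutative n w" "minimal_crowded n w"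
  shows "structured n w"
proof -
  interpret fc_perm n w using assms(1) by unfold_locales
  have "row2 (insertion_tableau n (w \<circ> simple_refl i)) \<noteq> row2 (insertion_tableau n w)"
    if "i \<in> descents n w" for i
    using assms(2) that unfolding minimal_crowded_iff[OF assms(1)] by metis
  then show ?thesis using descent_neighbours by unfold_locales blast+
qed

text \<open>The inequalities common to both patterns give \<open>link\<close> and the inner cases of
  \<open>below\<close> and \<open>above\<close>; the fixed points settle the two ends of the
  chain.\<close>

lemma single_chain_of_windows:
  assumes fc: "fully_commutative n w" and k: "k \<ge> 2"
    and D: "descents n w = (\<lambda>i. d + 2 * i) ` {0..k}"
    and fixed: "\<And>i. i \<in> {1..n} - {d..d + 2 * k + 1} \<Longrightarrow> w i = i"
    and windows: "\<And>i. i \<le> k - 2 \<Longrightarrow>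
          occurrence n w [4, 1, 5, 2, 6, 3] [d + 2 * i..<d + 2 * i + 6] \<or>
          occurrence n w [3, 1, 5, 2, 6, 4] [d + 2 * i..<d + 2 * i + 6]"
  shows "single_chain n w d k"
proof -
  interpret fc_perm n w using fc by unfold_locales
  have in_D: "d + 2 * i \<in> descents n w" if "i \<le> k" for i using that D by auto
  have bounds: "1 \<le> d" "d + 2 * k + 1 \<le> n" using in_D[of 0] in_D[of k] by (auto simp: descents_iff)
  have step: "w (d + 2 * i) < w (d + 2 * i + 2)" "w (d + 2 * i + 1) < w (d + 2 * i + 3)"
    "w (d + 2 * i + 3) < w (d + 2 * i)" if "i < k" for i
  proof -
    \<comment> \<open>For \<open>i = k - 1\<close> no window starts at \<open>i\<close>, so the
      second half of the last window is used.\<close>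
    define j where "j = min i (k - 2)"
    have j: "i = j \<or> i = j + 1" "j \<le> k - 2" using that by (auto simp: j_def)
    let ?p = "d + 2 * j"
    have ord: "w ?p < w (?p + 2)" "w (?p + 1) < w (?p + 3)" "w (?p + 3) < w ?p"
      "w (?p + 2) < w (?p + 4)" "w (?p + 3) < w (?p + 5)" "w (?p + 5) < w (?p + 2)"
      using windows[OF j(2)] unfolding upt_six occurrence_415263_iff occurrence_315264_iff by auto
    have e: "d + 2 * (j + 1) = ?p + 2" "?p + 2 + 2 = ?p + 4" "?p + 2 + 1 = ?p + 3" "?p + 2 + 3 = ?p + 5"
      by simp_all
    show "w (d + 2 * i) < w (d + 2 * i + 2)" "w (d + 2 * i + 1) < w (d + 2 * i + 3)"
      "w (d + 2 * i + 3) < w (d + 2 * i)"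
      using j(1) ord by (auto simp only: e)
  qed
  show ?thesis
  proof unfold_locales
    show "descents n w = (\<lambda>i. d + 2 * i) ` {0..k}" by (rule D)
    show "w (d + 2 * i + 3) < w (d + 2 * i)" if "i < k" for i using step that by blast
  next
    fix i assume i: "i \<in> descents n w" "1 < i"
    then obtain a where a: "a \<le> k" "i = d + 2 * a" using D by auto
    show "w (i - 1) < w (Suc i)"
    proof (cases a)
      case 0
      have "d - 1 \<in> {1..n} - {d..d + 2 * k + 1}"
        unfolding Diff_iff atLeastAtMost_iff using 0 a i bounds by linarith
      then have "w (d - 1) = d - 1" by (rule fixed)
      moreover have "\<not> w (Suc d) < d"
      proof
        assume *: "w (Suc d) < d"
        then have "w (w (Suc d)) = w (Suc d)"
          using fixed[of "w (Suc d)"] w_range[of "Suc d"] bounds by auto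
        then show False using * by (simp add: w_inj)
      qed
      ultimately show ?thesis using 0 a bounds by simp
    next
      case (Suc b)
      then have "i - 1 = d + 2 * b + 1" "Suc i = d + 2 * b + 3" using a by auto
      then show ?thesis using step(2)[of b] Suc a by (simp only:)
    qed
  next
    fix i assume i: "i \<in> descents n w" "i + 2 \<le> n"
    then obtain a where a: "a \<le> k" "i = d + 2 * a" using D by auto
    show "w i < w (i + 2)"
    proof (cases "a = k")
      case True
      have fix2: "w (i + 2) = i + 2" using fixed[of "i + 2"] True a i bounds by auto
      moreover have "\<not> i + 2 < w i"
      proof
        assume *: "i + 2 < w i"
        then have "w (w i) = w i"
          using fixed[of "w i"] w_range[of i] True a bounds by auto
        then show False using * by (simp add: w_inj)
      qed
      moreover have "w i \<noteq> w (i + 2)" by (simp add: w_inj)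
      ultimately show ?thesis by simp
    next
      case False
      then show ?thesis using step(1)[of a] a by simp
    qed
  qed
qed

section \<open>Characterisation of the minimal elements\<close>

theorem theorem5p15:
  fixes n :: nat and w :: "nat \<Rightarrow> nat"
  assumes "fully_commutative n w"
  shows "minimal_crowded n w \<longleftrightarrow>
    (\<exists>d k :: nat.
       k \<ge> 2 \<and> descents n w = (\<lambda>i. d + 2 * i) ` {0..k} \<and>
       crowded ((\<lambda>i. int (w (d + 2 * i))) ` {0..k}) \<and>
       (\<forall>i\<in>{1..n} - {d..d + 2 * k + 1}. w i = i) \<and>
       (contains_pattern n w [4, 1, 5, 2, 6, 3] \<and>
         (\<forall>ps. occurrence n w [4, 1, 5, 2, 6, 3] ps \<longrightarrow> consecutive_positions ps)) \<and>
       (\<forall>i\<in>{0..k - 2}.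
          occurrence n w [4, 1, 5, 2, 6, 3] [d + 2 * i..<d + 2 * i + 6] \<or>
          occurrence n w [3, 1, 5, 2, 6, 4] [d + 2 * i..<d + 2 * i + 6]))"
    (is "_ \<longleftrightarrow> ?R")
proof
  assume min: "minimal_crowded n w"
  interpret structured n w using structured_of_minimal[OF assms min] .
  have crowded: "crowded (int ` row2 (insertion_tableau n w))"
    and not_crowded: "\<And>i. i \<in> D \<Longrightarrow> \<not> crowded (int ` row2 (insertion_tableau n (w \<circ> simple_refl i)))"
    using min unfolding minimal_crowded_iff[OF assms] by blast+
  obtain d k where dk: "D = (\<lambda>i. d + 2 * i) ` {0..k}" "\<And>i. i < k \<Longrightarrow> w (d + 2 * i + 3) < w (d + 2 * i)"
    using minimal_single_chain[OF crowded not_crowded] by blast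
  interpret single_chain n w d k using dk by unfold_locales
  obtain i where i: "i + 2 \<le> k" "x (i + 2) < y i" using crowded_imp_long_overlap[OF crowded] by blast
  then have "2 \<le> k" by simp
  \<comment> \<open>All removals give the same second row, so the first descent may stand for
    all.\<close>
  have "\<not> crowded (int ` y ` {0..<k})"
    using not_crowded[OF in_D[of 0]] row2_comp_descent_chain[OF in_D[of 0]] by simp
  then have short: "\<And>i. i + 3 \<le> k \<Longrightarrow> y i < x (i + 3)" using not_crowded_initial_iff by blast
  have "crowded ((\<lambda>i. int (w (d + 2 * i))) ` {0..k})"
    using crowded unfolding row2_eq image_D by (simp only: image_image)
  moreover have "contains_pattern n w [4, 1, 5, 2, 6, 3]"
    unfolding contains_pattern_def using occurrence_window(1)[OF i] by blast
  moreover have "occurrence n w [4, 1, 5, 2, 6, 3] [d + 2 * i..<d + 2 * i + 6] \<or>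
          occurrence n w [3, 1, 5, 2, 6, 4] [d + 2 * i..<d + 2 * i + 6]" if "i \<in> {0..k - 2}" for i
    using occurrence_window[of i] that \<open>2 \<le> k\<close> by fastforce
  ultimately show ?R
    using dk(1) fixed_outside occurrence_consecutive[OF short] \<open>2 \<le> k\<close>
    by (intro exI[of _ d] exI[of _ k]) blast
next
  assume ?R
  then obtain d k where k: "k \<ge> 2" and D: "descents n w = (\<lambda>i. d + 2 * i) ` {0..k}"
    and crowded: "crowded ((\<lambda>i. int (w (d + 2 * i))) ` {0..k})"
    and fixed: "\<And>i. i \<in> {1..n} - {d..d + 2 * k + 1} \<Longrightarrow> w i = i"
    and consecutive: "\<And>ps. occurrence n w [4, 1, 5, 2, 6, 3] ps \<Longrightarrow> consecutive_positions ps"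
    and windows: "\<And>i. i \<in> {0..k - 2} \<Longrightarrow>
          occurrence n w [4, 1, 5, 2, 6, 3] [d + 2 * i..<d + 2 * i + 6] \<or>
          occurrence n w [3, 1, 5, 2, 6, 4] [d + 2 * i..<d + 2 * i + 6]"
    by blast
  interpret single_chain n w d k
    by (rule single_chain_of_windows[OF assms k D fixed]) (use windows in auto)
  \<comment> \<open>Otherwise \<open>x (i + 3)\<close> could replace \<open>x (i + 2)\<close> as the
    last letter, giving an occurrence of 415263 with a gap.\<close>
  have "y i < x (i + 3)" if i: "i + 3 \<le> k" for i
  proof (rule ccontr)
    let ?p = "d + 2 * i"
    assume "\<not> y i < x (i + 3)"
    moreover have "y i \<noteq> x (i + 3)" by (simp add: w_inj)
    ultimately have "x (i + 3) < y i" by linarith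
    moreover have "x i < x (i + 1)" "x (i + 1) < x (i + 3)" "y i < y (i + 1)" "y (i + 1) < y (i + 2)"
      using x_less[of i "i + 1"] x_less[of "i + 1" "i + 3"] y_less[of i "i + 1"]
        y_less[of "i + 1" "i + 2"] i by simp_all
    moreover have "1 \<le> ?p" "d + 2 * (i + 3) + 1 \<le> n" using bounds i by auto
    ultimately have "occurrence n w [4, 1, 5, 2, 6, 3]
      [?p, ?p + 1, d + 2 * (i + 1), d + 2 * (i + 1) + 1, d + 2 * (i + 2), d + 2 * (i + 3) + 1]"
      unfolding occurrence_415263_iff by simp
    from consecutive[OF this] obtain q where
      "[?p, ?p + 1, d + 2 * (i + 1), d + 2 * (i + 1) + 1, d + 2 * (i + 2), d + 2 * (i + 3) + 1] = [q..<q + 6]"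
      unfolding consecutive_positions_def by auto
    then show False unfolding upt_six by auto
  qed
  then have "\<not> crowded (int ` y ` {0..<k})" using not_crowded_initial_iff by blast
  moreover have "crowded (int ` row2 (insertion_tableau n w))"
    unfolding row2_eq image_D using crowded by (simp only: image_image)
  ultimately show "minimal_crowded n w"
    unfolding minimal_crowded_iff[OF assms] using row2_comp_descent_chain by simp
qed

end
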